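(* Let $(E,\theta)$ be a Higgs bundle over a compact Hermitian manifold $(M,\omega_g)$, and let $h$ and $h_0$ be smooth Hermitian metrics on $E$. If $\Lambda_{\omega_g}\left(\sqrt{-1}R^{D^{h_0}}\right)>0$ and $$\Lambda_{\omega_g}\left(\sqrt{-1}R^{D^h}\right)\le\Lambda_{\omega_g}\left(\sqrt{-1}R^{D^{h_0}}\right)$$ as Hermitian tensors in $\Gamma(M,E^*\otimes\overline E^* )$, then $h\le h_0$.
   Context: $M$ is a compact complex manifold, $g$ a smooth Hermitian metric on $M$ with fundamental form $\omega_g=\sqrt{-1}\,g_{i\bar j}dz^i\wedge d\bar z^j$ (not assumed closed), and $\Lambda_{\omega_g}(\sqrt{-1}\,a_{i\bar j}dz^i\wedge d\bar z^j)=g^{i\bar j}a_{i\bar j}$ (components of type $(2,0)$ and $(0,2)$ are sent to $0$). A Higgs bundle $(E,\theta)$ is a holomorphic vector bundle $E$ over $M$ with a smooth $(1,0)$-form $\theta\in\Omega^{1,0}(M,E^*\otimes E)$ with values in $E^*\otimes E=\mathrm{End}(E)$ satisfying $\bar\partial\theta=0$ (the condition $\theta\wedge\theta=0$ is not required). For a smooth Hermitian metric $h$ on $E$, $\nabla^h$ denotes the Chern connection of $(E,h)$, $\theta_h^\star\in\Omega^{0,1}(M,E^*\otimes E)$ denotes the Hermitian adjoint of $\theta$, defined by $h(\theta v,w)=h(v,\theta_h^\star w)$, and the Higgs connection is $D^h=\nabla^h+\theta+\theta_h^\star$. Its curvature is $\Theta^{D^h}=(D^h)^2$, and $R^{D^h}=\Theta^{D^h}\cdot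 h\in\Gamma(M,\Lambda^2T^*M\otimes E^*\otimes\overline{E}^* )$ is obtained by lowering the endomorphism index with $h$: $R^{D^h}_{\alpha\bar\beta}=h_{\gamma\bar\beta}(\Theta^{D^h})_\alpha^\gamma$. The Hermitian-Yang-Mills(-Higgs) tensor is the Hermitian form $\Lambda_{\omega_g}(\sqrt{-1}R^{D^h})=\left(g^{i\bar j}R^{D^h}_{i\bar j\alpha\bar\beta}\right)e^\alpha\otimes\bar e^\beta\in\Gamma(M,E^*\otimes\overline{E}^* )$. Inequalities $A\le B$, $A>0$ between Hermitian tensors in $\Gamma(M,E^*\otimes\overline E^* )$ (including Hermitian metrics) are pointwise inequalities of Hermitian forms on the fibres $E_x$, $x\in M$. *)

theory Defs
  imports "HOL-Analysis.Analysis"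
begin

section \<open>Calculus on open subsets of complex coordinate space\<close>

fun Ck_on :: "nat \<Rightarrow> ('a::real_normed_vector \<Rightarrow> 'b::real_normed_vector) \<Rightarrow> 'a set \<Rightarrow> bool" where
  "Ck_on 0 f S \<longleftrightarrow> continuous_on S f"
| "Ck_on (Suc k) f S \<longleftrightarrow>
     (\<forall>z\<in>S. f differentiable (at z)) \<and> (\<forall>v. Ck_on k (\<lambda>z. frechet_derivative f (at z) v) S)"

definition Cinf_on :: "('a::real_normed_vector \<Rightarrow> 'b::real_normed_vector) \<Rightarrow> 'a set \<Rightarrow> bool" where
  "Cinf_on f S \<longleftrightarrow> (\<forall>k. Ck_on k f S)"

definition holo_on :: "(complex^'n \<Rightarrow> complex) \<Rightarrow> (complex^'n) set \<Rightarrow> bool" where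
  "holo_on f S \<longleftrightarrow>
     (\<forall>z\<in>S. \<exists>L. (f has_derivative L) (at z) \<and> (\<forall>a v. L (a *s v) = a * L v))"

text \<open>
  The type \<^typ>\<open>'n + 'n\<close> indexes the complexified coordinate coframe: \<^term>\<open>Inl i\<close> stands for
  \<open>dz\<^sup>i\<close> and \<^term>\<open>Inr j\<close> for its conjugate. The partial derivatives dual to it are the
  Wirtinger derivatives.
\<close>

definition wirt :: "'n + 'n \<Rightarrow> (complex^'n \<Rightarrow> complex) \<Rightarrow> complex^'n \<Rightarrow> complex" where
  "wirt a F z = (let F' = frechet_derivative F (at z) in
     case a of
       Inl i \<Rightarrow> (F' (axis i 1) - \<i> * F' (axis i \<i>)) / 2
     | Inr j \<Rightarrow> (F' (axis j 1) + \<i> * F' (axis j \<i>)) / 2)"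

fun bar :: "'n + 'n \<Rightarrow> 'n + 'n" where
  "bar (Inl i) = Inr i"
| "bar (Inr i) = Inl i"


section \<open>Complex manifolds\<close>

type_synonym ('m, 'n) chart = "'m set \<times> ('m \<Rightarrow> complex^'n)"

definition local_rep :: "('m, 'n) chart \<Rightarrow> ('m \<Rightarrow> 'b) \<Rightarrow> complex^'n \<Rightarrow> 'b" where
  "local_rep c f = f \<circ> inv_into (fst c) (snd c)"

definition complex_manifold :: "'m topology \<Rightarrow> ('m, 'n::finite) chart set \<Rightarrow> bool" where
  "complex_manifold M \<A> \<longleftrightarrow>
     Hausdorff_space M \<and> second_countable M \<and>
     (\<Union>c\<in>\<A>. fst c) = topspace M \<and>
     (\<forall>(U, \<phi>)\<in>\<A>. openin M U \<and> open (\<phi> ` U) \<and>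
        homeomorphic_map (subtopology M U) (top_of_set (\<phi> ` U)) \<phi>) \<and>
     (\<forall>(U, \<phi>)\<in>\<A>. \<forall>(V, \<psi>)\<in>\<A>. \<forall>k.
        holo_on (local_rep (U, \<phi>) (\<lambda>y. \<psi> y $ k)) (\<phi> ` (U \<inter> V)))"

definition smooth_fun :: "('m, 'n::finite) chart set \<Rightarrow> 'm set \<Rightarrow> ('m \<Rightarrow> complex) \<Rightarrow> bool" where
  "smooth_fun \<A> W f \<longleftrightarrow> (\<forall>(U, \<phi>)\<in>\<A>. Cinf_on (local_rep (U, \<phi>) f) (\<phi> ` (U \<inter> W)))"

definition holo_fun :: "('m, 'n::finite) chart set \<Rightarrow> 'm set \<Rightarrow> ('m \<Rightarrow> complex) \<Rightarrow> bool" where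
  "holo_fun \<A> W f \<longleftrightarrow> (\<forall>(U, \<phi>)\<in>\<A>. holo_on (local_rep (U, \<phi>) f) (\<phi> ` (U \<inter> W)))"

definition pd :: "('m, 'n::finite) chart \<Rightarrow> 'n + 'n \<Rightarrow> ('m \<Rightarrow> complex) \<Rightarrow> 'm \<Rightarrow> complex" where
  "pd c a f x = wirt a (local_rep c f) (snd c x)"

text \<open>
  A Hermitian metric on the manifold is given by its components in each chart,
  \<open>g c x $ i $ j\<close> being the coefficient with holomorphic index \<open>i\<close> and antiholomorphic index \<open>j\<close>,
  subject to the tensorial transformation law.
\<close>

definition hermitian_metric ::
  "('m, 'n::finite) chart set \<Rightarrow> (('m, 'n) chart \<Rightarrow> 'm \<Rightarrow> complex^'n^'n) \<Rightarrow> bool" where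
  "hermitian_metric \<A> g \<longleftrightarrow>
     (\<forall>c\<in>\<A>. (\<forall>i j. smooth_fun \<A> (fst c) (\<lambda>x. g c x $ i $ j)) \<and>
        (\<forall>x\<in>fst c. (\<forall>i j. g c x $ j $ i = cnj (g c x $ i $ j)) \<and>
           (\<forall>v. v \<noteq> 0 \<longrightarrow> 0 < Re (\<Sum>i\<in>UNIV. \<Sum>j\<in>UNIV. g c x $ i $ j * v $ i * cnj (v $ j))))) \<and>
     (\<forall>c\<in>\<A>. \<forall>d\<in>\<A>. \<forall>x\<in>fst c \<inter> fst d. \<forall>i j.
        g c x $ i $ j =
          (\<Sum>k\<in>UNIV. \<Sum>l\<in>UNIV. g d x $ k $ l
             * pd c (Inl i) (\<lambda>y. snd d y $ k) x * cnj (pd c (Inl j) (\<lambda>y. snd d y $ l) x)))"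

text \<open>
  The contraction of a 2-form \<open>\<Sum>\<^bsub>p<q\<^esub> b p q dx\<^sup>p \<and> dx\<^sup>q\<close> with the fundamental form of the metric \<open>G\<close>.
  It is normalised by sending \<open>\<i> a\<^sub>i\<^sub>j\<close> times the wedge of \<open>dz\<^sup>i\<close> and the conjugate of \<open>dz\<^sup>j\<close> to
  \<open>\<Sum> g\<^sup>i\<^sup>j a\<^sub>i\<^sub>j\<close>, whence the division by \<^term>\<open>\<i>\<close>. The inverse metric satisfies
  \<open>\<Sum>\<^sub>j g\<^sup>i\<^sup>j g\<^sub>k\<^sub>j = \<delta>\<^sub>i\<^sub>k\<close>, whence the transposed indices.
\<close>

definition Lambda :: "complex^'n^'n \<Rightarrow> ('n + 'n \<Rightarrow> 'n + 'n \<Rightarrow> complex) \<Rightarrow> complex" where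
  "Lambda G b = (\<Sum>i\<in>UNIV. \<Sum>j\<in>UNIV. matrix_inv G $ j $ i * (b (Inl i) (Inr j) / \<i>))"


section \<open>Holomorphic vector bundles and Higgs fields\<close>

text \<open>
  \<open>E x\<close> is the fibre over \<open>x\<close>, and a local trivialisation over \<open>U\<close> is a family of bijections
  \<open>\<tau> x\<close> from \<open>E x\<close> to the standard fibre. The transition matrices being holomorphic, the
  trivialisations induce the vector space structure on the fibres and the topology and the complex
  structure on the total space.
\<close>

type_synonym ('m, 'e, 'r) triv = "'m set \<times> ('m \<Rightarrow> 'e \<Rightarrow> complex^'r)"

definition holomorphic_vector_bundle ::
  "'m topology \<Rightarrow> ('m, 'n::finite) chart set \<Rightarrow> ('m \<Rightarrow> 'e set) \<Rightarrow> ('m, 'e, 'r::finite) triv set \<Rightarrow> bool"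
  where
  "holomorphic_vector_bundle M \<A> E \<T> \<longleftrightarrow>
     (\<Union>t\<in>\<T>. fst t) = topspace M \<and>
     (\<forall>(U, \<tau>)\<in>\<T>. openin M U \<and> (\<forall>x\<in>U. bij_betw (\<tau> x) (E x) UNIV)) \<and>
     (\<forall>(U, \<tau>)\<in>\<T>. \<forall>(V, \<sigma>)\<in>\<T>. \<exists>G :: 'm \<Rightarrow> complex^'r^'r.
        (\<forall>\<alpha> \<beta>. holo_fun \<A> (U \<inter> V) (\<lambda>x. G x $ \<alpha> $ \<beta>)) \<and>
        (\<forall>x\<in>U \<inter> V. \<forall>u\<in>E x. \<sigma> x u = G x *v \<tau> x u))"

text \<open>The local holomorphic frame \<open>e\<^sub>\<alpha>\<close> of a trivialisation.\<close>

definition frame :: "('m \<Rightarrow> 'e set) \<Rightarrow> ('m, 'e, 'r::finite) triv \<Rightarrow> 'r \<Rightarrow> 'm \<Rightarrow> 'e" where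
  "frame E t \<alpha> x = inv_into (E x) (snd t x) (axis \<alpha> 1)"

definition is_zero :: "('m, 'e, 'r::finite) triv set \<Rightarrow> 'm \<Rightarrow> 'e \<Rightarrow> bool" where
  "is_zero \<T> x u \<longleftrightarrow> (\<exists>(U, \<tau>)\<in>\<T>. x \<in> U \<and> \<tau> x u = 0)"

text \<open>The matrix \<open>T\<^sub>\<gamma>\<^sub>\<alpha>\<close> of an endomorphism of \<open>E x\<close>, with \<open>T e\<^sub>\<alpha> = \<Sum>\<^sub>\<gamma> T\<^sub>\<gamma>\<^sub>\<alpha> e\<^sub>\<gamma>\<close>.\<close>

definition end_matrix ::
  "('m \<Rightarrow> 'e set) \<Rightarrow> ('m, 'e, 'r::finite) triv \<Rightarrow> 'm \<Rightarrow> ('e \<Rightarrow> 'e) \<Rightarrow> complex^'r^'r" where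
  "end_matrix E t x T = (\<chi> \<gamma> \<alpha>. snd t x (T (frame E t \<alpha> x)) $ \<gamma>)"

text \<open>
  A Higgs field is an endomorphism-valued (1,0)-form, given in a chart \<open>c\<close> as \<open>\<theta> = \<theta>\<^sub>i dz\<^sup>i\<close> with
  \<open>\<theta> c i x\<close> an endomorphism of \<open>E x\<close>. The conditions are: smooth dependence on the point,
  the transformation law of a (1,0)-form, and the vanishing of \<open>\<theta>\<close> under the Dolbeault operator,
  whose matrix in holomorphic coordinates and a holomorphic frame consists of the derivatives
  of the entries along the antiholomorphic directions.
\<close>

definition higgs_field ::
  "('m, 'n::finite) chart set \<Rightarrow> ('m \<Rightarrow> 'e set) \<Rightarrow> ('m, 'e, 'r::finite) triv set
     \<Rightarrow> (('m, 'n) chart \<Rightarrow> 'n \<Rightarrow> 'm \<Rightarrow> 'e \<Rightarrow> 'e) \<Rightarrow> bool" where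
  "higgs_field \<A> E \<T> \<theta> \<longleftrightarrow>
     (\<forall>c\<in>\<A>. \<forall>t\<in>\<T>. \<forall>i.
        (\<forall>x\<in>fst c \<inter> fst t. \<forall>u\<in>E x. \<theta> c i x u \<in> E x \<and>
            snd t x (\<theta> c i x u) = end_matrix E t x (\<theta> c i x) *v snd t x u) \<and>
        (\<forall>\<gamma> \<alpha>. smooth_fun \<A> (fst c \<inter> fst t) (\<lambda>x. end_matrix E t x (\<theta> c i x) $ \<gamma> $ \<alpha>)) \<and>
        (\<forall>x\<in>fst c \<inter> fst t. \<forall>j \<gamma> \<alpha>.
            pd c (Inr j) (\<lambda>y. end_matrix E t y (\<theta> c i y) $ \<gamma> $ \<alpha>) x = 0)) \<and>
     (\<forall>c\<in>\<A>. \<forall>d\<in>\<A>. \<forall>t\<in>\<T>. \<forall>x\<in>fst c \<inter> fst d \<inter> fst t. \<forall>i. \<forall>u\<in>E x.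
        snd t x (\<theta> c i x u) =
          (\<Sum>k\<in>UNIV. pd c (Inl i) (\<lambda>y. snd d y $ k) x *s snd t x (\<theta> d k x u)))"


section \<open>Hermitian metrics and Hermitian tensors on bundles\<close>

text \<open>
  A section of \<open>E\<^sup>*\<close> tensor its conjugate is represented by the forms \<open>A x u v\<close> for \<open>u\<close>, \<open>v\<close> in the
  fibre \<open>E x\<close>, linear in \<open>u\<close> and antilinear in \<open>v\<close>.
\<close>

type_synonym ('m, 'e) form = "'m \<Rightarrow> 'e \<Rightarrow> 'e \<Rightarrow> complex"

definition form_matrix ::
  "('m \<Rightarrow> 'e set) \<Rightarrow> ('m, 'e, 'r::finite) triv \<Rightarrow> ('m, 'e) form \<Rightarrow> 'm \<Rightarrow> complex^'r^'r" where
  "form_matrix E t h x = (\<chi> \<alpha> \<beta>. h x (frame E t \<alpha> x) (frame E t \<beta> x))"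

definition form_of_matrix :: "complex^'r^'r \<Rightarrow> complex^'r \<Rightarrow> complex^'r \<Rightarrow> complex" where
  "form_of_matrix H v w = (\<Sum>\<alpha>\<in>UNIV. \<Sum>\<beta>\<in>UNIV. H $ \<alpha> $ \<beta> * v $ \<alpha> * cnj (w $ \<beta>))"

definition tensor_pos ::
  "'m topology \<Rightarrow> ('m \<Rightarrow> 'e set) \<Rightarrow> ('m, 'e, 'r::finite) triv set \<Rightarrow> ('m, 'e) form \<Rightarrow> bool" where
  "tensor_pos M E \<T> A \<longleftrightarrow> (\<forall>x\<in>topspace M. \<forall>u\<in>E x. \<not> is_zero \<T> x u \<longrightarrow> 0 < Re (A x u u))"

definition tensor_le ::
  "'m topology \<Rightarrow> ('m \<Rightarrow> 'e set) \<Rightarrow> ('m, 'e) form \<Rightarrow> ('m, 'e) form \<Rightarrow> bool" where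
  "tensor_le M E A B \<longleftrightarrow> (\<forall>x\<in>topspace M. \<forall>u\<in>E x. Re (A x u u) \<le> Re (B x u u))"

definition hermitian_bundle_metric ::
  "'m topology \<Rightarrow> ('m, 'n::finite) chart set \<Rightarrow> ('m \<Rightarrow> 'e set) \<Rightarrow> ('m, 'e, 'r::finite) triv set
     \<Rightarrow> ('m, 'e) form \<Rightarrow> bool" where
  "hermitian_bundle_metric M \<A> E \<T> h \<longleftrightarrow>
     (\<forall>t\<in>\<T>. \<forall>x\<in>fst t. \<forall>u\<in>E x. \<forall>v\<in>E x.
        h x u v = form_of_matrix (form_matrix E t h x) (snd t x u) (snd t x v)) \<and>
     (\<forall>t\<in>\<T>. \<forall>\<alpha> \<beta>. smooth_fun \<A> (fst t) (\<lambda>x. form_matrix E t h x $ \<alpha> $ \<beta>)) \<and>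
     (\<forall>x\<in>topspace M. \<forall>u\<in>E x. \<forall>v\<in>E x. h x v u = cnj (h x u v)) \<and>
     tensor_pos M E \<T> h"


section \<open>The Higgs connection and its curvature\<close>

text \<open>
  In a chart and a local holomorphic frame a connection \<open>D\<close> is given by its connection matrices
  \<open>A a x\<close>, with \<open>D e\<^sub>\<alpha> = \<Sum>\<^sub>a \<Sum>\<^sub>\<gamma> (A a x)\<^sub>\<gamma>\<^sub>\<alpha> dx\<^sup>a e\<^sub>\<gamma>\<close>, and sections by their component vectors.
\<close>

type_synonym ('m, 'n, 'r) local_connection = "'n + 'n \<Rightarrow> 'm \<Rightarrow> complex^'r^'r"

definition cov_deriv ::
  "('m, 'n::finite) chart \<Rightarrow> ('m, 'n, 'r::finite) local_connection \<Rightarrow> 'n + 'n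
     \<Rightarrow> ('m \<Rightarrow> complex^'r) \<Rightarrow> 'm \<Rightarrow> complex^'r" where
  "cov_deriv c A a s x = (\<chi> \<gamma>. pd c a (\<lambda>y. s y $ \<gamma>) x) + A a x *v s x"

text \<open>The exterior covariant derivative of a bundle-valued 1-form \<open>\<sigma> = \<Sum>\<^sub>a \<sigma> a dx\<^sup>a\<close>.\<close>

definition ext_cov_deriv ::
  "('m, 'n::finite) chart \<Rightarrow> ('m, 'n, 'r::finite) local_connection
     \<Rightarrow> ('n + 'n \<Rightarrow> 'm \<Rightarrow> complex^'r) \<Rightarrow> 'n + 'n \<Rightarrow> 'n + 'n \<Rightarrow> 'm \<Rightarrow> complex^'r" where
  "ext_cov_deriv c A \<sigma> a b x = cov_deriv c A a (\<sigma> b) x - cov_deriv c A b (\<sigma> a) x"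

text \<open>The curvature \<open>D\<^sup>2\<close>: its matrix has as columns the values of \<open>D\<^sup>2\<close> on the frame.\<close>

definition curvature ::
  "('m, 'n::finite) chart \<Rightarrow> ('m, 'n, 'r::finite) local_connection
     \<Rightarrow> 'n + 'n \<Rightarrow> 'n + 'n \<Rightarrow> 'm \<Rightarrow> complex^'r^'r" where
  "curvature c A a b x =
     (\<chi> \<gamma> \<alpha>. ext_cov_deriv c A (\<lambda>b'. cov_deriv c A b' (\<lambda>_. axis \<alpha> 1)) a b x $ \<gamma>)"

text \<open>
  The Chern connection: its (0,1)-part is the Dolbeault operator, i.e. annihilates the holomorphic
  frame, and it is compatible with the metric,
  \<open>d (h e\<^sub>\<alpha> e\<^sub>\<beta>) = h (\<nabla> e\<^sub>\<alpha>) e\<^sub>\<beta> + h e\<^sub>\<alpha> (\<nabla> e\<^sub>\<beta>)\<close>. As \<open>h\<close> is antilinear in the second argument, the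
  component of the last summand along \<open>dx\<^sup>a\<close> involves the derivative in the conjugate direction.
\<close>

definition is_chern_at ::
  "('m, 'n::finite) chart \<Rightarrow> ('m \<Rightarrow> complex^'r^'r) \<Rightarrow> 'm \<Rightarrow> ('n + 'n \<Rightarrow> complex^'r^'r) \<Rightarrow> bool" where
  "is_chern_at c H x A \<longleftrightarrow>
     (\<forall>j. A (Inr j) = 0) \<and>
     (\<forall>a \<alpha> \<beta>. pd c a (\<lambda>y. H y $ \<alpha> $ \<beta>) x =
        (\<Sum>\<gamma>\<in>UNIV. A a $ \<gamma> $ \<alpha> * H x $ \<gamma> $ \<beta>) +
        (\<Sum>\<gamma>\<in>UNIV. H x $ \<alpha> $ \<gamma> * cnj (A (bar a) $ \<gamma> $ \<beta>)))"

definition chern_connection ::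
  "('m \<Rightarrow> 'e set) \<Rightarrow> ('m, 'e) form \<Rightarrow> ('m, 'n::finite) chart \<Rightarrow> ('m, 'e, 'r::finite) triv
     \<Rightarrow> ('m, 'n, 'r) local_connection" where
  "chern_connection E h c t a x = (THE A. is_chern_at c (form_matrix E t h) x A) a"

definition fibre_adjoint ::
  "('m \<Rightarrow> 'e set) \<Rightarrow> ('m, 'e) form \<Rightarrow> 'm \<Rightarrow> ('e \<Rightarrow> 'e) \<Rightarrow> 'e \<Rightarrow> 'e" where
  "fibre_adjoint E h x T w = (THE w'. w' \<in> E x \<and> (\<forall>v\<in>E x. h x (T v) w = h x v w'))"

text \<open>
  The matrices of \<open>\<theta>\<close> and of its adjoint. The latter is a (0,1)-form, its component along the
  conjugate of \<open>dz\<^sup>j\<close> being the fibrewise adjoint of \<open>\<theta>\<^sub>j\<close>.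
\<close>

definition higgs_form ::
  "('m \<Rightarrow> 'e set) \<Rightarrow> (('m, 'n::finite) chart \<Rightarrow> 'n \<Rightarrow> 'm \<Rightarrow> 'e \<Rightarrow> 'e)
     \<Rightarrow> ('m, 'n) chart \<Rightarrow> ('m, 'e, 'r::finite) triv \<Rightarrow> 'n + 'n \<Rightarrow> 'm \<Rightarrow> complex^'r^'r" where
  "higgs_form E \<theta> c t a x = (case a of Inl i \<Rightarrow> end_matrix E t x (\<theta> c i x) | Inr j \<Rightarrow> 0)"

definition higgs_adjoint_form ::
  "('m \<Rightarrow> 'e set) \<Rightarrow> (('m, 'n::finite) chart \<Rightarrow> 'n \<Rightarrow> 'm \<Rightarrow> 'e \<Rightarrow> 'e) \<Rightarrow> ('m, 'e) form
     \<Rightarrow> ('m, 'n) chart \<Rightarrow> ('m, 'e, 'r::finite) triv \<Rightarrow> 'n + 'n \<Rightarrow> 'm \<Rightarrow> complex^'r^'r" where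
  "higgs_adjoint_form E \<theta> h c t a x =
     (case a of Inl i \<Rightarrow> 0 | Inr j \<Rightarrow> end_matrix E t x (fibre_adjoint E h x (\<theta> c j x)))"

definition higgs_connection ::
  "('m \<Rightarrow> 'e set) \<Rightarrow> (('m, 'n::finite) chart \<Rightarrow> 'n \<Rightarrow> 'm \<Rightarrow> 'e \<Rightarrow> 'e) \<Rightarrow> ('m, 'e) form
     \<Rightarrow> ('m, 'n) chart \<Rightarrow> ('m, 'e, 'r::finite) triv \<Rightarrow> ('m, 'n, 'r) local_connection" where
  "higgs_connection E \<theta> h c t a x =
     chern_connection E h c t a x + higgs_form E \<theta> c t a x + higgs_adjoint_form E \<theta> h c t a x"

text \<open>\<open>R\<close>, the curvature of the Higgs connection with its endomorphism index lowered by \<open>h\<close>.\<close>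

definition higgs_curvature ::
  "('m \<Rightarrow> 'e set) \<Rightarrow> (('m, 'n::finite) chart \<Rightarrow> 'n \<Rightarrow> 'm \<Rightarrow> 'e \<Rightarrow> 'e) \<Rightarrow> ('m, 'e) form
     \<Rightarrow> ('m, 'n) chart \<Rightarrow> ('m, 'e, 'r::finite) triv \<Rightarrow> 'n + 'n \<Rightarrow> 'n + 'n \<Rightarrow> 'm \<Rightarrow> complex^'r^'r" where
  "higgs_curvature E \<theta> h c t a b x =
     (\<chi> \<alpha> \<beta>. \<Sum>\<gamma>\<in>UNIV. form_matrix E t h x $ \<gamma> $ \<beta>
        * curvature c (higgs_connection E \<theta> h c t) a b x $ \<gamma> $ \<alpha>)"

definition hym_matrix ::
  "('m \<Rightarrow> 'e set) \<Rightarrow> (('m, 'n::finite) chart \<Rightarrow> 'm \<Rightarrow> complex^'n^'n)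
     \<Rightarrow> (('m, 'n) chart \<Rightarrow> 'n \<Rightarrow> 'm \<Rightarrow> 'e \<Rightarrow> 'e) \<Rightarrow> ('m, 'e) form
     \<Rightarrow> ('m, 'n) chart \<Rightarrow> ('m, 'e, 'r::finite) triv \<Rightarrow> 'm \<Rightarrow> complex^'r^'r" where
  "hym_matrix E g \<theta> h c t x =
     (\<chi> \<alpha> \<beta>. Lambda (g c x) (\<lambda>a b. \<i> * higgs_curvature E \<theta> h c t a b x $ \<alpha> $ \<beta>))"

text \<open>
  The Hermitian-Yang-Mills tensor. It is computed at each point in an arbitrarily chosen chart and
  trivialisation around that point; being a tensor, it does not depend on this choice.
\<close>

definition hym_tensor ::
  "('m, 'n::finite) chart set \<Rightarrow> ('m \<Rightarrow> 'e set) \<Rightarrow> ('m, 'e, 'r::finite) triv set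
     \<Rightarrow> (('m, 'n) chart \<Rightarrow> 'm \<Rightarrow> complex^'n^'n) \<Rightarrow> (('m, 'n) chart \<Rightarrow> 'n \<Rightarrow> 'm \<Rightarrow> 'e \<Rightarrow> 'e)
     \<Rightarrow> ('m, 'e) form \<Rightarrow> ('m, 'e) form" where
  "hym_tensor \<A> E \<T> g \<theta> h x u v =
     (let c = (SOME c. c \<in> \<A> \<and> x \<in> fst c); t = (SOME t. t \<in> \<T> \<and> x \<in> fst t)
      in form_of_matrix (hym_matrix E g \<theta> h c t x) (snd t x u) (snd t x v))"


section \<open>Existence and uniqueness of the Chern connection\<close>

lemma wirt_cnj_aux:
  fixes F G :: "complex^'n \<Rightarrow> complex"
  assumes op: "open S" and z: "z \<in> S" and eq: "\<And>w. w \<in> S \<Longrightarrow> G w = cnj (F w)"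
    and d: "F differentiable (at z)"
  shows "wirt (bar a) G z = cnj (wirt a F z)"
proof -
  have F': "(F has_derivative frechet_derivative F (at z)) (at z)"
    using d frechet_derivative_works by blast
  have "((\<lambda>w. cnj (F w)) has_derivative (\<lambda>v. cnj (frechet_derivative F (at z) v))) (at z)"
    by (intro has_derivative_cnj F')
  then have "(G has_derivative (\<lambda>v. cnj (frechet_derivative F (at z) v))) (at z)"
    by (rule has_derivative_transform_within_open[OF _ op z]) (simp add: eq)
  then have "frechet_derivative G (at z) = (\<lambda>v. cnj (frechet_derivative F (at z) v))"
    using frechet_derivative_at by force
  then show ?thesis
    by (cases a) (simp_all add: wirt_def Let_def)
qed

lemma pos_def_invertible:
  fixes H :: "complex^'r^'r"
  assumes "\<And>v. v \<noteq> 0 \<Longrightarrow> 0 < Re (form_of_matrix H v v)"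
  shows "invertible H"
proof -
  have "v = 0" if "transpose H *v v = 0" for v
  proof (rule ccontr)
    assume "v \<noteq> 0"
    have "form_of_matrix H v v = (\<Sum>\<beta>\<in>UNIV. (transpose H *v v) $ \<beta> * cnj (v $ \<beta>))"
      unfolding form_of_matrix_def
      unfolding sum.swap[of "\<lambda>\<alpha> \<beta>. H $ \<alpha> $ \<beta> * v $ \<alpha> * cnj (v $ \<beta>)"] by (simp add: matrix_vector_mult_def transpose_def sum_distrib_right)
    then have "form_of_matrix H v v = 0" using that by simp
    then show False using assms[OF \<open>v \<noteq> 0\<close>] by simp
  qed
  then have "invertible (transpose H)"
    using matrix_left_invertible_ker[of "transpose H"] invertible_left_inverse by blast
  then show ?thesis 
    unfolding invertible_def by (metis matrix_transpose_mul transpose_mat transpose_transpose)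
qed

lemma chern_ex1:
  fixes \<A> :: "('m, 'n::finite) chart set" and \<T> :: "('m, 'e, 'r::finite) triv set"
  assumes M: "complex_manifold M \<A>" and B: "holomorphic_vector_bundle M \<A> E \<T>"
    and h: "hermitian_bundle_metric M \<A> E \<T> h"
    and c: "c \<in> \<A>" "x \<in> fst c" and t: "t \<in> \<T>" "x \<in> fst t"
  shows "\<exists>!A. is_chern_at c (form_matrix E t h) x A"
proof -
  let ?H = "form_matrix E t h"
  obtain U \<phi> where cU: "c = (U, \<phi>)" by (cases c)
  obtain V \<tau> where tV: "t = (V, \<tau>)" by (cases t)
  have U: "openin M U" "open (\<phi> ` U)" "homeomorphic_map (subtopology M U) (top_of_set (\<phi> ` U)) \<phi>"
    using M c cU unfolding complex_manifold_def by auto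
  have V: "openin M V" "\<And>y. y \<in> V \<Longrightarrow> bij_betw (\<tau> y) (E y) UNIV"
    using B t tV unfolding holomorphic_vector_bundle_def by auto
  have UM: "topspace (subtopology M U) = U" using U(1) openin_subset by fastforce
  have inj: "inj_on \<phi> U" using homeomorphic_imp_injective_map[OF U(3)] UM by simp
  let ?S = "\<phi> ` (U \<inter> V)"
  have "openin (top_of_set (\<phi> ` U)) ?S"
    using homeomorphic_map_openness[OF U(3), of "U \<inter> V"] UM U(1) V(1)
    by (metis inf.cobounded1 openin_Int openin_open_subtopology)
  then have opS: "open ?S" using U(2) openin_open_trans by blast
  have xS: "\<phi> x \<in> ?S" using c t cU tV by auto
  have VM: "V \<subseteq> topspace M" using V(1) openin_subset by blast
  have fr: "frame E t \<alpha> y \<in> E y" if "y \<in> V" for y \<alpha>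
    using V(2)[OF that] tV unfolding frame_def bij_betw_def
    by (metis UNIV_I inv_into_into snd_conv)
  have herm: "?H y $ \<beta> $ \<alpha> = cnj (?H y $ \<alpha> $ \<beta>)" if "y \<in> V" for y \<alpha> \<beta>
  proof -
    have "h y v u = cnj (h y u v)" if "u \<in> E y" "v \<in> E y" for u v
      using h \<open>y \<in> V\<close> VM that unfolding hermitian_bundle_metric_def by blast
    from this[OF fr[OF \<open>y \<in> V\<close>, of \<alpha>] fr[OF \<open>y \<in> V\<close>, of \<beta>]]
    show ?thesis unfolding form_matrix_def vec_lambda_beta .
  qed
  have inve: "inv_into U \<phi> z \<in> V" if "z \<in> ?S" for z using that inj by auto
  have diff: "local_rep c (\<lambda>y. ?H y $ \<alpha> $ \<beta>) differentiable (at (\<phi> x))" for \<alpha> \<beta>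
  proof -
    have "smooth_fun \<A> (fst t) (\<lambda>x. ?H x $ \<alpha> $ \<beta>)"
      using h t unfolding hermitian_bundle_metric_def by blast
    then have "Cinf_on (local_rep c (\<lambda>y. ?H y $ \<alpha> $ \<beta>)) ?S"
      using c cU tV unfolding smooth_fun_def by auto
    then have "Ck_on (Suc 0) (local_rep c (\<lambda>y. ?H y $ \<alpha> $ \<beta>)) ?S"
      unfolding Cinf_on_def by blast
    then show ?thesis using xS unfolding Ck_on.simps by blast
  qed
  have pdc: "pd c (bar a) (\<lambda>y. ?H y $ \<beta> $ \<alpha>) x = cnj (pd c a (\<lambda>y. ?H y $ \<alpha> $ \<beta>) x)" for a \<alpha> \<beta>
    unfolding pd_def
  proof (rule wirt_cnj_aux[where S="?S"])
    show "open ?S" "snd c x \<in> ?S" using opS xS cU by simp_all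
    show "local_rep c (\<lambda>y. ?H y $ \<alpha> $ \<beta>) differentiable at (snd c x)" using diff cU by simp
    show "local_rep c (\<lambda>y. ?H y $ \<beta> $ \<alpha>) w = cnj (local_rep c (\<lambda>y. ?H y $ \<alpha> $ \<beta>) w)" if "w \<in> ?S" for w
      using herm[OF inve[OF that], where \<alpha>=\<alpha> and \<beta>=\<beta>] cU by (simp add: local_rep_def)
  qed
  have xV: "x \<in> V" using t tV by simp
  have inv: "invertible (?H x)"
  proof (rule pos_def_invertible)
    fix v :: "complex^'r" assume "v \<noteq> 0"
    define u where "u = inv_into (E x) (\<tau> x) v"
    have u: "u \<in> E x" "\<tau> x u = v"
      using V(2)[OF xV] unfolding u_def bij_betw_def by (auto intro: inv_into_into f_inv_into_f)
    have nz: "\<not> is_zero \<T> x u"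
    proof
      assume "is_zero \<T> x u"
      then obtain W \<sigma> where W: "(W, \<sigma>) \<in> \<T>" "x \<in> W" "\<sigma> x u = 0" unfolding is_zero_def by auto
      have "\<exists>G :: 'm \<Rightarrow> complex^'r^'r. \<forall>y\<in>W \<inter> V. \<forall>u\<in>E y. \<tau> y u = G y *v \<sigma> y u"
      proof -
        have "\<forall>(U, \<tau>)\<in>\<T>. \<forall>(V, \<sigma>)\<in>\<T>. \<exists>G :: 'm \<Rightarrow> complex^'r^'r.
          (\<forall>\<alpha> \<beta>. holo_fun \<A> (U \<inter> V) (\<lambda>x. G x $ \<alpha> $ \<beta>)) \<and>
          (\<forall>x\<in>U \<inter> V. \<forall>u\<in>E x. \<sigma> x u = G x *v \<tau> x u)"
          using B unfolding holomorphic_vector_bundle_def by (elim conjE)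
        from bspec[OF this W(1), unfolded case_prod_conv, THEN bspec, OF t(1)[unfolded tV], unfolded case_prod_conv]
        show ?thesis by (elim exE conjE) (rule exI)
      qed
      then obtain G :: "'m \<Rightarrow> complex^'r^'r" where G: "\<forall>y\<in>W \<inter> V. \<forall>u\<in>E y. \<tau> y u = G y *v \<sigma> y u" by (elim exE)
      have "\<tau> x u = 0" using G[rule_format, OF IntI[OF W(2) xV] u(1)] W(3) by simp
      then show False using u \<open>v \<noteq> 0\<close> by simp
    qed
    have "0 < Re (h x u u)"
      using h nz u xV VM unfolding hermitian_bundle_metric_def tensor_pos_def by blast
    moreover have "h x u u = form_of_matrix (?H x) v v"
      using h t u tV unfolding hermitian_bundle_metric_def by force
    ultimately show "0 < Re (form_of_matrix (?H x) v v)" by simp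
  qed
  obtain K where K: "?H x ** K = mat 1" "K ** ?H x = mat 1"
    using inv unfolding invertible_def by blast
  define P where "P a = (\<chi> \<alpha> \<beta>. pd c a (\<lambda>y. ?H y $ \<alpha> $ \<beta>) x)" for a
  have chern: "is_chern_at c ?H x A \<longleftrightarrow>
     (\<forall>j. A (Inr j) = 0) \<and> (\<forall>i. A (Inl i) = transpose (P (Inl i) ** K))" (is "_ \<longleftrightarrow> ?R") for A
  proof -
    have s: "(\<Sum>\<gamma>\<in>UNIV. A a $ \<gamma> $ \<alpha> * ?H x $ \<gamma> $ \<beta>) = (transpose (A a) ** ?H x) $ \<alpha> $ \<beta>" for a \<alpha> \<beta>
      by (simp add: matrix_matrix_mult_def transpose_def)
    have e: "(transpose X ** ?H x = Q) \<longleftrightarrow> X = transpose (Q ** K)" for X Q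
    proof
      assume "transpose X ** ?H x = Q"
      then have "Q ** K = transpose X" using K(1) by (auto simp: matrix_mul_assoc[symmetric])
      then show "X = transpose (Q ** K)" by (simp add: transpose_transpose)
    next
      assume "X = transpose (Q ** K)"
      then have "transpose X = Q ** K" by (simp add: transpose_transpose)
      then show "transpose X ** ?H x = Q" using K(2) by (simp add: matrix_mul_assoc[symmetric])
    qed
    have l: "(\<forall>\<alpha> \<beta>. pd c (Inl i) (\<lambda>y. ?H y $ \<alpha> $ \<beta>) x =
        (\<Sum>\<gamma>\<in>UNIV. A (Inl i) $ \<gamma> $ \<alpha> * ?H x $ \<gamma> $ \<beta>)) \<longleftrightarrow> A (Inl i) = transpose (P (Inl i) ** K)" for i
      unfolding s e[symmetric] P_def by (simp add: vec_eq_iff) metis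
    have r: "pd c (Inr i) (\<lambda>y. ?H y $ \<alpha> $ \<beta>) x = (\<Sum>\<gamma>\<in>UNIV. ?H x $ \<alpha> $ \<gamma> * cnj (A (Inl i) $ \<gamma> $ \<beta>))"
      if "\<forall>\<alpha> \<beta>. pd c (Inl i) (\<lambda>y. ?H y $ \<alpha> $ \<beta>) x = (\<Sum>\<gamma>\<in>UNIV. A (Inl i) $ \<gamma> $ \<alpha> * ?H x $ \<gamma> $ \<beta>)"
      for i \<alpha> \<beta>
    proof -
      have "pd c (Inr i) (\<lambda>y. ?H y $ \<alpha> $ \<beta>) x = cnj (\<Sum>\<gamma>\<in>UNIV. A (Inl i) $ \<gamma> $ \<beta> * ?H x $ \<gamma> $ \<alpha>)"
        using pdc[where a="Inl i" and \<alpha>=\<beta> and \<beta>=\<alpha>] that[rule_format, of \<beta> \<alpha>] unfolding bar.simps by (simp only:)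
      also have "\<dots> = (\<Sum>\<gamma>\<in>UNIV. ?H x $ \<alpha> $ \<gamma> * cnj (A (Inl i) $ \<gamma> $ \<beta>))"
        unfolding cnj_sum
      proof (rule sum.cong[OF refl])
        show "cnj (A (Inl i) $ \<gamma> $ \<beta> * ?H x $ \<gamma> $ \<alpha>) = ?H x $ \<alpha> $ \<gamma> * cnj (A (Inl i) $ \<gamma> $ \<beta>)" for \<gamma>
          using herm[OF xV, where \<alpha>=\<gamma> and \<beta>=\<alpha>] by simp
      qed
      finally show ?thesis .
    qed
    have "is_chern_at c ?H x A \<longleftrightarrow> (\<forall>j. A (Inr j) = 0) \<and>
      (\<forall>i. \<forall>\<alpha> \<beta>. pd c (Inl i) (\<lambda>y. ?H y $ \<alpha> $ \<beta>) x = (\<Sum>\<gamma>\<in>UNIV. A (Inl i) $ \<gamma> $ \<alpha> * ?H x $ \<gamma> $ \<beta>))"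
      (is "?L \<longleftrightarrow> ?Q")
    proof
      assume ?L
      then show ?Q unfolding is_chern_at_def by simp
    next
      assume Q: ?Q
      show ?L unfolding is_chern_at_def
      proof (intro conjI allI)
        show "A (Inr j) = 0" for j using Q by simp
        show "pd c a (\<lambda>y. ?H y $ \<alpha> $ \<beta>) x = (\<Sum>\<gamma>\<in>UNIV. A a $ \<gamma> $ \<alpha> * ?H x $ \<gamma> $ \<beta>) +
          (\<Sum>\<gamma>\<in>UNIV. ?H x $ \<alpha> $ \<gamma> * cnj (A (bar a) $ \<gamma> $ \<beta>))" for a \<alpha> \<beta>
          using Q r by (cases a) simp_all
      qed
    qed
    then show ?thesis unfolding l .
  qed
  show ?thesis
  proof (rule ex1I[where a="\<lambda>a. case a of Inl i \<Rightarrow> transpose (P (Inl i) ** K) | Inr j \<Rightarrow> 0"])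
    show "is_chern_at c ?H x (\<lambda>a. case a of Inl i \<Rightarrow> transpose (P (Inl i) ** K) | Inr j \<Rightarrow> 0)"
      unfolding chern by simp
    show "A = (\<lambda>a. case a of Inl i \<Rightarrow> transpose (P (Inl i) ** K) | Inr j \<Rightarrow> 0)"
      if "is_chern_at c ?H x A" for A
      using that unfolding chern by (auto split: sum.split)
  qed
qed

end

theory Submission
  imports Defs
begin

text \<open>
  The theorem follows from the maximum principle, applied to the largest ratio between \<open>h\<close> and
  \<open>h\<^sub>0\<close>. If \<open>h \<le> h\<^sub>0\<close> fails, compactness of \<open>M\<close> provides a number \<open>\<lambda> > 1\<close> with \<open>h \<le> \<lambda> h\<^sub>0\<close>
  everywhere and with equality on some vector \<open>u \<noteq> 0\<close> over some point \<open>x\<close>: the infimum \<open>\<lambda>\<close> of the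
  factors \<open>l\<close> with \<open>h < l h\<^sub>0\<close> is not one of them, because this strict inequality is an open
  condition both on the point (\<open>strictly_below_nbhd\<close>) and on \<open>l\<close> (\<open>strictly_below_smaller\<close>).

  It remains to compare the curvatures at \<open>x\<close>. In a holomorphic frame let \<open>Q\<close> be the matrix of
  \<open>\<lambda> h\<^sub>0 - h\<close> near \<open>x\<close>. It is positive semidefinite with null vector \<open>u\<close> at \<open>x\<close>, so for every
  complex direction \<open>a\<close> and every first-order variation \<open>u + t w\<close> of \<open>u\<close> along the complex line
  \<open>x + t a\<close> the function \<open>Q(u + t w, u + t w)\<close> has a minimum at \<open>t = 0\<close> and a nonnegative Laplacian
  there (\<open>levi_nonneg\<close>). The variation that is parallel for the Chern connection of \<open>h\<^sub>0\<close>
  makes this an inequality between the Chern curvatures,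
  \<open>\<lambda> R\<^sup>0(a, a; u, u) \<le> R(a, a; u, u)\<close>; the square of the norm of the covariant derivative with
  respect to \<open>h\<close> has the good sign.

  In the direction \<open>a\<close> the Higgs field contributes \<open>h(\<theta>\<^sup>* u, \<theta>\<^sup>* u) - h(\<theta> u, \<theta> u)\<close> to the curvature of \<open>h\<close>
  (\<open>lowered_curvature\<close>). From \<open>h \<le> \<lambda> h\<^sub>0\<close> one gets \<open>h(\<theta> u, \<theta> u) \<le> \<lambda> h\<^sub>0(\<theta> u, \<theta> u)\<close>. As \<open>u\<close> lies in
  the kernel of \<open>\<lambda> h\<^sub>0 - h\<close>, the two adjoints satisfy
  \<open>h(\<cdot>, \<theta>\<^sup>*\<^sub>h u) = \<lambda> h\<^sub>0(\<cdot>, \<theta>\<^sup>*\<^sub>0 u)\<close>, whence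
  \<open>h(\<theta>\<^sup>*\<^sub>h u, \<theta>\<^sup>*\<^sub>h u) \<ge> \<lambda> h\<^sub>0(\<theta>\<^sup>*\<^sub>0 u, \<theta>\<^sup>*\<^sub>0 u)\<close>. So the inequality persists for the Higgs curvatures
  (\<open>curvature_comparison\<close>). Its trace with respect to \<open>g\<close> (\<open>trace_nonneg\<close>) reads
  \<open>\<lambda> K\<^sup>0(u, u) \<le> K(u, u)\<close> for the Hermitian-Yang-Mills tensors \<open>K\<^sup>0\<close> of \<open>h\<^sub>0\<close> and \<open>K\<close> of \<open>h\<close>, which
  contradicts \<open>K \<le> K\<^sup>0\<close>, \<open>K\<^sup>0 > 0\<close> and \<open>\<lambda> > 1\<close>.
\<close>


section \<open>Positive definite sesquilinear forms\<close>

text \<open>The standard Hermitian product on complex coordinate space, linear in the first argument.\<close>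

definition cip :: "complex^'r \<Rightarrow> complex^'r \<Rightarrow> complex" where
  "cip v w = (\<Sum>\<beta>\<in>UNIV. v $ \<beta> * cnj (w $ \<beta>))"

text \<open>The conjugate transpose of a matrix.\<close>

definition adj :: "complex^'n^'m \<Rightarrow> complex^'m^'n" where
  "adj A = (\<chi> i j. cnj (A $ j $ i))"

text \<open>
  Positive definiteness of the form \<open>(v, w) \<mapsto> cip (P v) w\<close>. Only the real part is constrained, and
  the matrix need not be Hermitian.
\<close>

definition posdef :: "complex^'r^'r \<Rightarrow> bool" where
  "posdef P \<longleftrightarrow> (\<forall>v. v \<noteq> 0 \<longrightarrow> 0 < Re (cip (P *v v) v))"

lemma cip_add_left: "cip (u + v) w = cip u w + cip v w"
  and cip_add_right: "cip u (v + w) = cip u v + cip u w"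
  and cip_diff_left: "cip (u - v) w = cip u w - cip v w"
  and cip_diff_right: "cip u (v - w) = cip u v - cip u w"
  and cip_minus_left: "cip (- u) w = - cip u w"
  and cip_minus_right: "cip u (- w) = - cip u w"
  and cip_scale_left: "cip (a *s u) w = a * cip u w"
  and cip_scale_right: "cip u (a *s w) = cnj a * cip u w"
  and cip_zero_left [simp]: "cip 0 w = 0"
  and cip_zero_right [simp]: "cip w 0 = 0"
  by (simp_all add: cip_def algebra_simps sum.distrib sum_subtractf sum_negf sum_distrib_left)

lemma cip_sum_left: "cip (\<Sum>i\<in>I. f i) w = (\<Sum>i\<in>I. cip (f i) w)"
  by (induction I rule: infinite_finite_induct) (simp_all add: cip_add_left)

lemma cip_sum_right: "cip w (\<Sum>i\<in>I. f i) = (\<Sum>i\<in>I. cip w (f i))"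
  by (induction I rule: infinite_finite_induct) (simp_all add: cip_add_right)

lemma cnj_cip: "cnj (cip v w) = cip w v"
  by (simp add: cip_def mult.commute)

lemma cip_axis: "cip u (axis i 1) = u $ i"
proof -
  have "cip u (axis i 1) = (\<Sum>\<beta>\<in>UNIV. if \<beta> = i then u $ \<beta> else 0)"
    unfolding cip_def by (rule sum.cong) (auto simp: axis_def)
  then show ?thesis by simp
qed

lemma cip_adj: "cip (A *v v) w = cip v (adj A *v w)"
  by (simp add: cip_def adj_def matrix_vector_mult_def sum_distrib_left sum_distrib_right)
    (subst sum.swap, simp add: ac_simps)

lemma cip_mult_expand: "cip (A *v v) w = (\<Sum>i\<in>UNIV. \<Sum>j\<in>UNIV. A $ i $ j * v $ j * cnj (w $ i))"
  by (simp add: cip_def matrix_vector_mult_def sum_distrib_right)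

lemma cip_ext: "(\<And>u. cip u v = cip u w) \<Longrightarrow> v = w"
  by (metis cip_axis cnj_cip vec_eq_iff)

lemma adj_adj [simp]: "adj (adj A) = A"
  by (simp add: adj_def vec_eq_iff)

lemma adj_mult: "adj (A ** B) = adj B ** adj A"
  by (simp add: adj_def vec_eq_iff matrix_matrix_mult_def mult.commute)

lemma form_of_matrix_cip: "form_of_matrix H v w = cip (transpose H *v v) w"
  unfolding form_of_matrix_def cip_mult_expand by (subst sum.swap) (simp add: transpose_def)

lemma form_of_matrix_combination:
  "form_of_matrix (\<chi> \<alpha> \<beta>. \<Sum>i\<in>UNIV. \<Sum>j\<in>UNIV. m i j * R i j $ \<alpha> $ \<beta>) v w
     = (\<Sum>i\<in>UNIV. \<Sum>j\<in>UNIV. m i j * form_of_matrix (R i j) v w)"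
  for R :: "'n::finite \<Rightarrow> 'n \<Rightarrow> complex^'r^'r"
proof -
  have lin: "form_of_matrix (\<chi> \<alpha> \<beta>. \<Sum>i\<in>UNIV. f i $ \<alpha> $ \<beta>) v w = (\<Sum>i\<in>UNIV. form_of_matrix (f i) v w)"
    for f :: "'n \<Rightarrow> complex^'r^'r"
  proof -
    have "form_of_matrix (\<chi> \<alpha> \<beta>. \<Sum>i\<in>UNIV. f i $ \<alpha> $ \<beta>) v w =
        (\<Sum>\<alpha>\<in>UNIV. \<Sum>i\<in>UNIV. \<Sum>\<beta>\<in>UNIV. f i $ \<alpha> $ \<beta> * v $ \<alpha> * cnj (w $ \<beta>))"
      unfolding form_of_matrix_def vec_lambda_beta sum_distrib_right by (rule sum.cong[OF refl]) (rule sum.swap)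
    also have "\<dots> = (\<Sum>i\<in>UNIV. form_of_matrix (f i) v w)"
      unfolding form_of_matrix_def by (rule sum.swap)
    finally show ?thesis .
  qed
  have "form_of_matrix (\<chi> \<alpha> \<beta>. m i j * R i j $ \<alpha> $ \<beta>) v w = m i j * form_of_matrix (R i j) v w" for i j
    by (simp add: form_of_matrix_def sum_distrib_left mult.assoc)
  then show ?thesis
    using lin[of "\<lambda>i. \<chi> \<alpha> \<beta>. \<Sum>j\<in>UNIV. m i j * R i j $ \<alpha> $ \<beta>"]
      lin[of "\<lambda>j. \<chi> \<alpha> \<beta>. m i j * R i j $ \<alpha> $ \<beta>" for i] by simp
qed

lemma hermitian_cip:
  assumes "adj P = P"
  shows "cip (P *v v) w = cnj (cip (P *v w) v)"
  by (metis assms cip_adj cnj_cip)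

lemma matrix_vector_mult_minus_right: "A *v (- v) = - (A *v (v::complex^'n))"
  by (simp add: vec_eq_iff matrix_vector_mult_def sum_negf)

lemma matrix_vector_mult_minus_left: "(- A) *v v = - (A *v (v::complex^'n))"
  by (simp add: vec_eq_iff matrix_vector_mult_def sum_negf)

lemma matrix_vector_mult_sum_right: "A *v (\<Sum>i\<in>I. f i) = (\<Sum>i\<in>I. A *v (f i :: complex^'n))"
  by (induction I rule: infinite_finite_induct) (simp_all add: matrix_vector_right_distrib)

lemma matrix_vector_mult_axis: "(A *v axis \<alpha> 1) $ \<gamma> = (A $ \<gamma> $ \<alpha> :: complex)"
proof -
  have "(A *v axis \<alpha> 1) $ \<gamma> = (\<Sum>\<beta>\<in>UNIV. if \<beta> = \<alpha> then A $ \<gamma> $ \<beta> else 0)"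
    unfolding matrix_vector_mult_def vec_lambda_beta by (rule sum.cong) (auto simp: axis_def)
  then show ?thesis by simp
qed

lemma matrix_mult_distribs:
  fixes A B C :: "complex^'n^'n"
  shows "A ** (B + C) = A ** B + A ** C" "(A + B) ** C = A ** C + B ** C"
    "A ** (B - C) = A ** B - A ** C" "(A - B) ** C = A ** C - B ** C"
  by (simp_all add: vec_eq_iff matrix_matrix_mult_def algebra_simps sum.distrib sum_subtractf)

lemma adj_scaled_diff: "adj (r *\<^sub>R P - Q) = r *\<^sub>R adj P - adj Q"
  by (simp add: adj_def vec_eq_iff)

lemma cip_scaled_diff: "cip ((r *\<^sub>R P - Q) *v v) w = r *\<^sub>R cip (P *v v) w - cip (Q *v v) w"
  by (simp add: cip_mult_expand sum_subtractf left_diff_distrib scaleR_sum_right)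

lemma posdefD: "posdef P \<Longrightarrow> v \<noteq> 0 \<Longrightarrow> 0 < Re (cip (P *v v) v)"
  by (simp add: posdef_def)

lemma posdefD_ge: "posdef P \<Longrightarrow> 0 \<le> Re (cip (P *v v) v)"
  by (cases "v = 0") (auto dest: posdefD simp: less_imp_le)

lemma posdef_invertible: "posdef P \<Longrightarrow> invertible P"
  by (metis cip_zero_left invertible_left_inverse matrix_left_invertible_ker posdefD less_irrefl
      zero_complex.simps(1))

lemma posdef_inverse:
  assumes "posdef P"
  obtains K where "P ** K = mat 1" "K ** P = mat 1"
  using posdef_invertible[OF assms] unfolding invertible_def by blast

text \<open>Positive definiteness may be tested on unit vectors.\<close>

lemma posdefI_unit:
  fixes P :: "complex^'r^'r"
  assumes "\<And>v. norm v = 1 \<Longrightarrow> 0 < Re (cip (P *v v) v)"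
  shows "posdef P"
  unfolding posdef_def
proof (intro allI impI)
  fix v :: "complex^'r" assume v: "v \<noteq> 0"
  let ?w = "complex_of_real (1 / norm v) *s v"
  have "?w $ i = ((1 / norm v) *\<^sub>R v) $ i" for i
    by (simp only: vector_smult_component vector_scaleR_component scaleR_conv_of_real[where 'a=complex])
  then have "?w = (1 / norm v) *\<^sub>R v" unfolding vec_eq_iff by blast
  then have "norm ?w = 1" using v by simp
  from assms[OF this] have "0 < Re (cip (P *v ?w) ?w)" .
  also have "cip (P *v ?w) ?w = complex_of_real ((1 / norm v)\<^sup>2) * cip (P *v v) v"
    by (simp add: vector_scalar_commute cip_scale_left cip_scale_right power2_eq_square)
  also have "Re \<dots> = (1 / norm v)\<^sup>2 * Re (cip (P *v v) v)" by simp
  finally show "0 < Re (cip (P *v v) v)" by (simp add: zero_less_mult_iff)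
qed

text \<open>Positive definiteness is an open condition on the entries of the matrix.\<close>

lemma posdef_eventually:
  fixes P :: "'a \<Rightarrow> complex^'r^'r"
  assumes P0: "posdef P0" and lim: "\<And>\<alpha> \<beta>. ((\<lambda>y. P y $ \<alpha> $ \<beta>) \<longlongrightarrow> P0 $ \<alpha> $ \<beta>) F"
  shows "\<forall>\<^sub>F y in F. posdef (P y)"
proof -
  let ?S = "sphere (0::complex^'r) 1"
  have "continuous_on ?S (\<lambda>v. Re (cip (P0 *v v) v))"
    unfolding cip_mult_expand by (intro continuous_intros)
  moreover have "?S \<noteq> {}" by simp
  ultimately obtain v0 where v0: "v0 \<in> ?S"
    and min: "\<And>v. v \<in> ?S \<Longrightarrow> Re (cip (P0 *v v0) v0) \<le> Re (cip (P0 *v v) v)"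
    using continuous_attains_inf[of ?S] compact_sphere by blast
  define m where "m = Re (cip (P0 *v v0) v0)"
  have "v0 \<noteq> 0" using v0 by auto
  then have m: "0 < m" using P0 unfolding m_def by (rule posdefD[rotated])
  have "((\<lambda>y. \<Sum>\<alpha>\<in>UNIV. \<Sum>\<beta>\<in>UNIV. norm (P y $ \<alpha> $ \<beta> - P0 $ \<alpha> $ \<beta>)) \<longlongrightarrow>
      (\<Sum>\<alpha>\<in>(UNIV::'r set). \<Sum>\<beta>\<in>(UNIV::'r set). norm (P0 $ \<alpha> $ \<beta> - P0 $ \<alpha> $ \<beta>))) F"
    by (intro tendsto_intros lim)
  then have "((\<lambda>y. \<Sum>\<alpha>\<in>UNIV. \<Sum>\<beta>\<in>UNIV. norm (P y $ \<alpha> $ \<beta> - P0 $ \<alpha> $ \<beta>)) \<longlongrightarrow> 0) F" by simp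
  from order_tendstoD(2)[OF this m] show ?thesis
  proof eventually_elim
    case (elim y)
    show ?case
    proof (rule posdefI_unit)
      fix v :: "complex^'r" assume v: "norm v = 1"
      have comp: "norm (v $ \<alpha>) \<le> 1" for \<alpha> using Finite_Cartesian_Product.norm_nth_le[of v \<alpha>] v by simp
      have "cip (P0 *v v) v - cip (P y *v v) v =
        (\<Sum>\<alpha>\<in>UNIV. \<Sum>\<beta>\<in>UNIV. (P0 $ \<alpha> $ \<beta> - P y $ \<alpha> $ \<beta>) * v $ \<beta> * cnj (v $ \<alpha>))"
        unfolding cip_mult_expand by (simp add: sum_subtractf algebra_simps)
      also have "norm \<dots> \<le> (\<Sum>\<alpha>\<in>UNIV. \<Sum>\<beta>\<in>UNIV. norm (P y $ \<alpha> $ \<beta> - P0 $ \<alpha> $ \<beta>))"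
      proof (intro order.trans[OF norm_sum] sum_mono)
        fix \<alpha> \<beta> :: 'r
        have "norm ((P0 $ \<alpha> $ \<beta> - P y $ \<alpha> $ \<beta>) * v $ \<beta> * cnj (v $ \<alpha>)) =
          norm (P y $ \<alpha> $ \<beta> - P0 $ \<alpha> $ \<beta>) * (norm (v $ \<beta>) * norm (v $ \<alpha>))"
          by (simp add: norm_mult norm_minus_commute)
        also have "\<dots> \<le> norm (P y $ \<alpha> $ \<beta> - P0 $ \<alpha> $ \<beta>) * 1"
          using mult_mono[OF comp comp] by (intro mult_left_mono) auto
        finally show "norm ((P0 $ \<alpha> $ \<beta> - P y $ \<alpha> $ \<beta>) * v $ \<beta> * cnj (v $ \<alpha>))
          \<le> norm (P y $ \<alpha> $ \<beta> - P0 $ \<alpha> $ \<beta>)" by simp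
      qed
      finally have "norm (cip (P0 *v v) v - cip (P y *v v) v) < m" using elim by linarith
      then have "Re (cip (P0 *v v) v - cip (P y *v v) v) < m"
        by (rule le_less_trans[OF complex_Re_le_cmod])
      moreover have "m \<le> Re (cip (P0 *v v) v)" using min[of v] v unfolding m_def by simp
      ultimately show "0 < Re (cip (P y *v v) v)" by simp
    qed
  qed
qed

text \<open>
  A vector on which a positive semidefinite form vanishes lies in its kernel: otherwise the form
  would become negative after a small perturbation.
\<close>

lemma semidefinite_null_kernel:
  assumes herm: "adj Q = Q" and psd: "\<And>v. 0 \<le> Re (cip (Q *v v) v)"
    and null: "Re (cip (Q *v u) u) \<le> 0"
  shows "Q *v u = 0"
proof -
  let ?w = "Q *v u"
  define a where "a = Re (cip ?w ?w)"
  define b where "b = Re (cip (Q *v ?w) ?w)"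
  have b: "0 \<le> b" unfolding b_def by (rule psd)
  have u0: "Re (cip (Q *v u) u) = 0" using null psd[of u] by linarith
  have ineq: "2 * s * a \<le> s\<^sup>2 * b" for s :: real
  proof -
    let ?v = "u - complex_of_real s *s ?w"
    have e: "cip (Q *v ?w) u = cip ?w ?w"
      by (metis cip_adj herm)
    have "cip (Q *v ?v) ?v = cip (Q *v u) u - complex_of_real s * cip ?w ?w
       - complex_of_real s * cip ?w ?w + complex_of_real (s\<^sup>2) * cip (Q *v ?w) ?w"
      by (simp add: matrix_vector_mult_diff_distrib vector_scalar_commute cip_diff_left
        cip_diff_right cip_scale_left cip_scale_right e power2_eq_square algebra_simps)
    then have "Re (cip (Q *v ?v) ?v) = - s * a - s * a + s\<^sup>2 * b"
      using u0 unfolding a_def b_def by simp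
    then show ?thesis using psd[of ?v] by (simp add: ac_simps)
  qed
  have "a \<le> 0"
  proof (rule ccontr)
    assume "\<not> a \<le> 0"
    then have a: "0 < a" by simp
    let ?s = "a / (b + 1)"
    have s: "0 < ?s" using a b by simp
    have "?s * (2 * a) \<le> ?s * (?s * b)" using ineq[of ?s] by (simp add: power2_eq_square mult.assoc mult.left_commute)
    then have "2 * a \<le> ?s * b" by (rule mult_left_le_imp_le[OF _ s])
    also have "?s * b \<le> a" using a b by (simp add: field_simps)
    finally show False using a by simp
  qed
  moreover have "a = (\<Sum>\<beta>\<in>UNIV. (norm (?w $ \<beta>))\<^sup>2)"
    unfolding a_def cip_def by (simp add: complex_mult_cnj cmod_power2)
  ultimately have "(\<Sum>\<beta>\<in>UNIV. (norm (?w $ \<beta>))\<^sup>2) = 0"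
    by (simp add: antisym sum_nonneg)
  then show ?thesis by (simp add: sum_nonneg_eq_0_iff vec_eq_iff)
qed

text \<open>
  A positive definite Hermitian form has an orthonormal basis, constructed one vector at a time.
  The rows of \<open>A\<close> below are such a basis for the form with matrix \<open>G\<close>.
\<close>

lemma hermitian_orthonormal_basis:
  fixes G :: "complex^'n^'n"
  assumes herm: "adj G = G" and pos: "\<And>v. v \<noteq> 0 \<Longrightarrow> 0 < Re (form_of_matrix G v v)"
  obtains A :: "complex^'n^'n" where "A ** G ** adj A = mat 1"
proof -
  let ?f = "form_of_matrix G"
  have f_herm: "?f v w = cnj (?f w v)" for v w
  proof -
    have "cnj (G $ i $ j) = G $ j $ i" for i j
      using arg_cong[OF herm, of "\<lambda>X. X $ j $ i"] by (simp add: adj_def)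
    then have "cnj (?f w v) = (\<Sum>\<alpha>\<in>UNIV. \<Sum>\<beta>\<in>UNIV. G $ \<beta> $ \<alpha> * v $ \<beta> * cnj (w $ \<alpha>))"
      by (simp add: form_of_matrix_def ac_simps)
    also have "\<dots> = ?f v w" unfolding form_of_matrix_def by (rule sum.swap)
    finally show ?thesis by simp
  qed
  \<comment> \<open>orthonormal families indexed by a subset \<open>I\<close> of \<open>'n\<close>\<close>
  have "\<exists>a :: 'n \<Rightarrow> complex^'n. \<forall>k\<in>I. \<forall>l\<in>I. ?f (a k) (a l) = (if k = l then 1 else 0)" if "finite I" for I
    using that
  proof (induction I rule: finite_induct)
    case empty
    then show ?case by simp
  next
    case (insert k I)
    then obtain a where a: "\<forall>k\<in>I. \<forall>l\<in>I. ?f (a k) (a l) = (if k = l then 1 else 0)" by blast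
    define B :: "complex^'n^'n" where
      "B = (\<chi> l. if l \<in> I then (\<chi> i. \<Sum>j\<in>UNIV. G $ i $ j * cnj (a l $ j)) else 0)"
    \<comment> \<open>the row of index \<open>k\<close> vanishes, so there is a vector orthogonal to the ones already found\<close>
    have "B $ k = 0" using insert.hyps by (simp add: B_def)
    then have "(B ** C) $ k $ k \<noteq> mat 1 $ k $ k" for C :: "complex^'n^'n"
      by (simp add: matrix_matrix_mult_def mat_def)
    then have "\<not> invertible B" unfolding invertible_def by metis
    then obtain w where w: "B *v w = 0" "w \<noteq> 0"
      using matrix_left_invertible_ker[of B] invertible_left_inverse by blast
    have orth: "?f w (a l) = 0" if "l \<in> I" for l
    proof -
      have "(B *v w) $ l = ?f w (a l)"
        using that by (simp add: B_def matrix_vector_mult_def form_of_matrix_def sum_distrib_left sum_distrib_right ac_simps)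
      then show ?thesis using w by simp
    qed
    have "Im (?f w w) = 0" using arg_cong[OF f_herm[of w w], of Im] by simp
    define r where "r = Re (?f w w)"
    have r: "?f w w = of_real r" "0 < r" using \<open>Im (?f w w) = 0\<close> pos[OF w(2)] by (simp_all add: r_def complex_eq_iff)
    define b where "b = of_real (1 / sqrt r) *s w"
    have s: "?f (c *s v) v' = c * ?f v v'" "?f v (c *s v') = cnj c * ?f v v'" for c v v'
      by (simp_all add: form_of_matrix_def sum_distrib_left ac_simps)
    have "?f b b = of_real (1 / sqrt r * (1 / sqrt r) * r)"
      unfolding b_def s r(1) by (simp only: complex_cnj_complex_of_real of_real_mult mult.assoc)
    also have "1 / sqrt r * (1 / sqrt r) * r = 1" using r(2) by (simp add: field_simps)
    finally have bb: "?f b b = 1" by simp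
    have bl: "?f b (a l) = 0" if "l \<in> I" for l using orth[OF that] unfolding b_def s by simp
    have lb: "?f (a l) b = 0" if "l \<in> I" for l using bl[OF that] f_herm[of "a l" b] by simp
    show ?case
      by (rule exI[of _ "a(k := b)"]) (use insert.hyps a bb bl lb in auto)
  qed
  from this[of UNIV] obtain a :: "'n \<Rightarrow> complex^'n"
    where a: "\<And>k l. ?f (a k) (a l) = (if k = l then 1 else 0)" by auto
  define A where "A = (\<chi> k. a k)"
  have "(A ** G ** adj A) $ k $ l = ?f (a k) (a l)" for k l
  proof -
    have "(A ** G ** adj A) $ k $ l = (\<Sum>j\<in>UNIV. \<Sum>i\<in>UNIV. G $ i $ j * a k $ i * cnj (a l $ j))"
      by (simp add: A_def adj_def matrix_matrix_mult_def sum_distrib_right sum_distrib_left ac_simps)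
    also have "\<dots> = ?f (a k) (a l)" unfolding form_of_matrix_def by (rule sum.swap)
    finally show ?thesis .
  qed
  then have "A ** G ** adj A = mat 1" by (simp add: vec_eq_iff a mat_def)
  then show ?thesis by (rule that)
qed

text \<open>
  The trace with respect to a Hermitian metric of a form that is nonnegative on every vector is
  nonnegative: in an orthonormal basis \<open>a\<^sub>k\<close> it is \<open>\<Sum>\<^sub>k B(a\<^sub>k, a\<^sub>k)\<close>.
\<close>

lemma trace_nonneg:
  fixes G :: "complex^'n^'n"
  assumes herm: "adj G = G" and pos: "\<And>v. v \<noteq> 0 \<Longrightarrow> 0 < Re (form_of_matrix G v v)"
    and B: "\<And>a :: complex^'n. 0 \<le> Re (\<Sum>i\<in>UNIV. \<Sum>j\<in>UNIV. a $ i * cnj (a $ j) * B i j)"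
  shows "0 \<le> Re (\<Sum>i\<in>UNIV. \<Sum>j\<in>UNIV. matrix_inv G $ j $ i * B i j)"
proof -
  obtain A :: "complex^'n^'n" where A: "A ** G ** adj A = mat 1"
    using hermitian_orthonormal_basis[OF herm pos] by blast
  then have A': "A ** (G ** adj A) = mat 1" by (simp add: matrix_mul_assoc)
  then have "(G ** adj A) ** A = mat 1" by (rule matrix_left_right_inverse[THEN iffD1])
  then have G1: "G ** (adj A ** A) = mat 1" by (simp add: matrix_mul_assoc)
  then have G2: "(adj A ** A) ** G = mat 1" by (rule matrix_left_right_inverse[THEN iffD1])
  have inv: "invertible G" unfolding invertible_def using G1 G2 by blast
  have "G ** matrix_inv G = mat 1 \<and> matrix_inv G ** G = mat 1"
    using inv unfolding invertible_def matrix_inv_def by (rule someI_ex)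
  then have "matrix_inv G = matrix_inv G ** (G ** (adj A ** A))" and "matrix_inv G ** G = mat 1"
    using G1 by simp_all
  then have "matrix_inv G = adj A ** A" by (simp add: matrix_mul_assoc)
  then have e: "matrix_inv G $ j $ i = (\<Sum>k\<in>UNIV. A $ k $ i * cnj (A $ k $ j))" for i j
    by (simp add: matrix_matrix_mult_def adj_def mult.commute)
  have "(\<Sum>i\<in>UNIV. \<Sum>j\<in>UNIV. matrix_inv G $ j $ i * B i j) =
    (\<Sum>i\<in>UNIV. \<Sum>j\<in>UNIV. \<Sum>k\<in>UNIV. A $ k $ i * cnj (A $ k $ j) * B i j)"
    by (simp add: e sum_distrib_right)
  also have "\<dots> = (\<Sum>i\<in>UNIV. \<Sum>k\<in>UNIV. \<Sum>j\<in>UNIV. A $ k $ i * cnj (A $ k $ j) * B i j)"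
    by (intro sum.cong refl sum.swap)
  also have "\<dots> = (\<Sum>k\<in>UNIV. \<Sum>i\<in>UNIV. \<Sum>j\<in>UNIV. A $ k $ i * cnj (A $ k $ j) * B i j)"
    by (rule sum.swap)
  finally show ?thesis
    using B by (simp only: Re_sum[of _ "UNIV"]) (simp add: sum_nonneg)
qed


section \<open>Wirtinger calculus for matrix-valued functions\<close>

lemma wirt_eqI:
  assumes "(F has_derivative F') (at z)"
  shows "wirt a F z = (case a of Inl i \<Rightarrow> (F' (axis i 1) - \<i> * F' (axis i \<i>)) / 2
     | Inr j \<Rightarrow> (F' (axis j 1) + \<i> * F' (axis j \<i>)) / 2)"
  unfolding wirt_def frechet_derivative_at[OF assms, symmetric] by (simp add: Let_def)

lemma wirt_const [simp]: "wirt a (\<lambda>_. k) z = 0"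
  by (subst wirt_eqI[of _ "\<lambda>_. 0"]) (auto split: sum.split)

lemma wirt_add:
  assumes "F differentiable (at z)" "G differentiable (at z)"
  shows "wirt a (\<lambda>w. F w + G w) z = wirt a F z + wirt a G z"
  by (subst wirt_eqI[OF has_derivative_add[OF assms[unfolded frechet_derivative_works]]])
    (simp add: wirt_def Let_def add_divide_distrib diff_divide_distrib algebra_simps split: sum.split)

lemma wirt_diff:
  assumes "F differentiable (at z)" "G differentiable (at z)"
  shows "wirt a (\<lambda>w. F w - G w) z = wirt a F z - wirt a G z"
  by (subst wirt_eqI[OF has_derivative_diff[OF assms[unfolded frechet_derivative_works]]])
    (simp add: wirt_def Let_def add_divide_distrib diff_divide_distrib algebra_simps split: sum.split)

lemma wirt_mult:
  assumes "F differentiable (at z)" "G differentiable (at z)"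
  shows "wirt a (\<lambda>w. F w * G w) z = wirt a F z * G z + F z * wirt a G z"
  by (subst wirt_eqI[OF has_derivative_mult[OF assms[unfolded frechet_derivative_works]]])
    (simp add: wirt_def Let_def add_divide_distrib diff_divide_distrib algebra_simps split: sum.split)

lemma wirt_sum:
  assumes "finite I" "\<And>i. i \<in> I \<Longrightarrow> F i differentiable (at z)"
  shows "wirt a (\<lambda>w. \<Sum>i\<in>I. F i w) z = (\<Sum>i\<in>I. wirt a (F i) z)"
  using assms
proof (induction I rule: finite_induct)
  case (insert i I)
  then have "(\<lambda>w. \<Sum>i\<in>I. F i w) differentiable (at z)"
    by (intro differentiable_sum) auto
  then show ?case using insert by (simp add: wirt_add)
qed simp

lemma frechet_derivative_cong:
  assumes "open S" "z \<in> S" "\<And>w. w \<in> S \<Longrightarrow> F w = G w"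
  shows "frechet_derivative F (at z) = frechet_derivative G (at z)"
proof -
  have "(F has_derivative D) (at z) \<longleftrightarrow> (G has_derivative D) (at z)" for D
    using has_derivative_transform_within_open[OF _ assms(1,2), of F D UNIV G]
      has_derivative_transform_within_open[OF _ assms(1,2), of G D UNIV F] assms(3) by auto
  then show ?thesis by (simp add: frechet_derivative_def)
qed

lemma differentiable_cong:
  assumes "open S" "z \<in> S" "\<And>w. w \<in> S \<Longrightarrow> F w = G w" "F differentiable (at z)"
  shows "G differentiable (at z)"
  using assms(4) has_derivative_transform_within_open[OF _ assms(1,2), of F _ UNIV G] assms(3)
  unfolding differentiable_def by blast

lemma frechet_derivative_cnj:
  assumes "F differentiable (at z)"
  shows "frechet_derivative (\<lambda>w. cnj (F w)) (at z) v = cnj (frechet_derivative F (at z) v)"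
  by (simp add: frechet_derivative_at[OF has_derivative_cnj[OF assms[unfolded frechet_derivative_works]], symmetric])

lemma wirt_cong:
  assumes "open S" "z \<in> S" "\<And>w. w \<in> S \<Longrightarrow> F w = G w"
  shows "wirt a F z = wirt a G z"
  by (simp only: wirt_def frechet_derivative_cong[OF assms])

text \<open>Directional form of the Wirtinger derivatives along a complex direction \<open>a\<close>.\<close>

lemma wirt_direction:
  fixes F :: "complex^'n \<Rightarrow> complex" and a :: "complex^'n"
  assumes "F differentiable (at z)"
  defines "D \<equiv> frechet_derivative F (at z)"
  shows "(\<Sum>i\<in>UNIV. a $ i * wirt (Inl i) F z) = (D a - \<i> * D (\<i> *s a)) / 2"
    and "(\<Sum>j\<in>UNIV. cnj (a $ j) * wirt (Inr j) F z) = (D a + \<i> * D (\<i> *s a)) / 2"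
proof -
  have "linear D"
    unfolding D_def using assms(1) has_derivative_linear frechet_derivative_works by blast
  then interpret linear D .
  have expand: "D b = (\<Sum>i\<in>UNIV. complex_of_real (Re (b $ i)) * D (axis i 1) + complex_of_real (Im (b $ i)) * D (axis i \<i>))" for b
  proof -
    have "b = (\<Sum>i\<in>UNIV. Re (b $ i) *\<^sub>R axis i 1 + Im (b $ i) *\<^sub>R axis i \<i>)"
    proof (subst vec_eq_iff, intro allI)
      fix k
      have "(\<Sum>i\<in>UNIV. Re (b $ i) *\<^sub>R axis i 1 + Im (b $ i) *\<^sub>R axis i \<i>) $ k =
        (\<Sum>i\<in>UNIV. if i = k then complex_of_real (Re (b $ i)) + \<i> * complex_of_real (Im (b $ i)) else 0)"
        by (simp only: sum_component, rule sum.cong) (auto simp: axis_def complex_eq_iff)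
      then show "b $ k = (\<Sum>i\<in>UNIV. Re (b $ i) *\<^sub>R axis i 1 + Im (b $ i) *\<^sub>R axis i \<i>) $ k"
        by (simp add: complex_eq[symmetric])
    qed
    then have "D b = D (\<Sum>i\<in>UNIV. Re (b $ i) *\<^sub>R axis i 1 + Im (b $ i) *\<^sub>R axis i \<i>)" by simp
    then show ?thesis by (simp only: sum add scaleR scaleR_conv_of_real[where 'a=complex])
  qed
  have c1: "a $ i = complex_of_real (Re (a $ i)) + \<i> * complex_of_real (Im (a $ i))"
    and c2: "cnj (a $ i) = complex_of_real (Re (a $ i)) - \<i> * complex_of_real (Im (a $ i))" for i
    by (simp_all add: complex_eq_iff)
  show "(\<Sum>i\<in>UNIV. a $ i * wirt (Inl i) F z) = (D a - \<i> * D (\<i> *s a)) / 2"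
    unfolding expand[of a] expand[of "\<i> *s a"] sum_distrib_left sum_subtractf[symmetric] sum_divide_distrib
  proof (rule sum.cong[OF refl])
    fix i
    show "a $ i * wirt (Inl i) F z =
      (complex_of_real (Re (a $ i)) * D (axis i 1) + complex_of_real (Im (a $ i)) * D (axis i \<i>) -
       \<i> * (complex_of_real (Re ((\<i> *s a) $ i)) * D (axis i 1) + complex_of_real (Im ((\<i> *s a) $ i)) * D (axis i \<i>))) / 2"
      by (subst c1) (simp add: wirt_def Let_def D_def[symmetric] algebra_simps diff_divide_distrib add_divide_distrib)
  qed
  show "(\<Sum>i\<in>UNIV. cnj (a $ i) * wirt (Inr i) F z) = (D a + \<i> * D (\<i> *s a)) / 2"
    unfolding expand[of a] expand[of "\<i> *s a"] sum_distrib_left sum.distrib[symmetric] sum_divide_distrib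
  proof (rule sum.cong[OF refl])
    fix i
    show "cnj (a $ i) * wirt (Inr i) F z =
      (complex_of_real (Re (a $ i)) * D (axis i 1) + complex_of_real (Im (a $ i)) * D (axis i \<i>) +
       \<i> * (complex_of_real (Re ((\<i> *s a) $ i)) * D (axis i 1) + complex_of_real (Im ((\<i> *s a) $ i)) * D (axis i \<i>))) / 2"
      by (subst c2) (simp add: wirt_def Let_def D_def[symmetric] algebra_simps diff_divide_distrib add_divide_distrib)
  qed
qed

text \<open>Entrywise Wirtinger derivative and differentiability of matrix-valued functions.\<close>

definition mwirt :: "'n + 'n \<Rightarrow> (complex^'n \<Rightarrow> complex^'r^'q) \<Rightarrow> complex^'n \<Rightarrow> complex^'r^'q" where
  "mwirt a X z = (\<chi> \<alpha> \<beta>. wirt a (\<lambda>w. X w $ \<alpha> $ \<beta>) z)"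

definition mdiff :: "(complex^'n \<Rightarrow> complex^'r^'q) \<Rightarrow> complex^'n \<Rightarrow> bool" where
  "mdiff X z \<longleftrightarrow> (\<forall>\<alpha> \<beta>. (\<lambda>w. X w $ \<alpha> $ \<beta>) differentiable (at z))"

lemma mwirt_cong:
  assumes "open S" "z \<in> S" "\<And>w. w \<in> S \<Longrightarrow> X w = Y w"
  shows "mwirt a X z = mwirt a Y z"
  unfolding mwirt_def vec_eq_iff vec_lambda_beta
  by (intro allI wirt_cong[OF assms(1,2)]) (simp add: assms(3))

lemma mdiff_mult: "mdiff X z \<Longrightarrow> mdiff Y z \<Longrightarrow> mdiff (\<lambda>w. X w ** Y w) z"
  by (simp add: mdiff_def matrix_matrix_mult_def)

lemma mwirt_add:
  "mdiff X z \<Longrightarrow> mdiff Y z \<Longrightarrow> mwirt a (\<lambda>w. X w + Y w) z = mwirt a X z + mwirt a Y z"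
  by (simp add: mdiff_def mwirt_def vec_eq_iff wirt_add)

lemma mwirt_mult:
  "mdiff X z \<Longrightarrow> mdiff Y z \<Longrightarrow> mwirt a (\<lambda>w. X w ** Y w) z = mwirt a X z ** Y z + X z ** mwirt a Y z"
  by (simp add: mdiff_def mwirt_def vec_eq_iff matrix_matrix_mult_def wirt_sum wirt_mult sum.distrib)

lemma mwirt_adj:
  assumes "mdiff X z"
  shows "mwirt (bar a) (\<lambda>w. adj (X w)) z = adj (mwirt a X z)" "mdiff (\<lambda>w. adj (X w)) z"
proof -
  have d: "(\<lambda>w. X w $ \<alpha> $ \<beta>) differentiable (at z)" for \<alpha> \<beta> using assms by (simp add: mdiff_def)
  show "mwirt (bar a) (\<lambda>w. adj (X w)) z = adj (mwirt a X z)"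
    unfolding mwirt_def adj_def vec_eq_iff vec_lambda_beta
    by (intro allI wirt_cnj_aux[OF open_UNIV UNIV_I refl d])
  show "mdiff (\<lambda>w. adj (X w)) z"
    unfolding mdiff_def adj_def vec_lambda_beta
    by (intro allI differentiableI[OF has_derivative_cnj[OF d[unfolded frechet_derivative_works]]])
qed

lemma wirt_cip:
  assumes "mdiff X z"
  shows "wirt a (\<lambda>w. cip (X w *v x) y) z = cip (mwirt a X z *v x) y"
  using assms unfolding cip_mult_expand mwirt_def
  by (simp add: mdiff_def wirt_sum wirt_mult)

lemma mdiff_det:
  assumes "mdiff X z"
  shows "(\<lambda>w. det (X w)) differentiable (at z)"
proof -
  have "(\<lambda>w. \<Prod>i\<in>UNIV. X w $ i $ p i) differentiable (at z)" for p
  proof -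
    have "((\<lambda>w. X w $ i $ p i) has_derivative frechet_derivative (\<lambda>w. X w $ i $ p i) (at z)) (at z)" for i
      using assms unfolding mdiff_def frechet_derivative_works by blast
    then show ?thesis by (rule differentiableI[OF has_derivative_prod])
  qed
  then show ?thesis unfolding det_def by (intro differentiable_sum differentiable_mult) simp_all
qed

text \<open>
  Solutions of a linear system with differentiable coefficients and right-hand side are
  differentiable, by Cramer's rule. This covers the Chern connection and the adjoint of the Higgs
  field, which are given by the inverse of the metric.
\<close>

lemma mdiff_solution:
  fixes P X Y :: "complex^'n \<Rightarrow> complex^'r^'r"
  assumes S: "open S" "z \<in> S" and eq: "\<And>w. w \<in> S \<Longrightarrow> P w ** X w = Y w"
    and inv: "\<And>w. w \<in> S \<Longrightarrow> invertible (P w)" and P: "mdiff P z" and Y: "mdiff Y z"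
  shows "mdiff X z"
  unfolding mdiff_def
proof (intro allI)
  fix k \<beta>
  let ?N = "\<lambda>w. (\<chi> i j. if j = k then Y w $ i $ \<beta> else P w $ i $ j)"
  have entry: "det (?N w) / det (P w) = X w $ k $ \<beta>" if "w \<in> S" for w
  proof -
    have "P w *v (\<chi> k. X w $ k $ \<beta>) = (\<chi> k. Y w $ k $ \<beta>)"
      unfolding eq[OF that, symmetric] by (simp add: matrix_vector_mult_def matrix_matrix_mult_def)
    moreover have "det (P w) \<noteq> 0" using inv[OF that] by (simp add: invertible_det_nz)
    ultimately have "(\<chi> k. X w $ k $ \<beta>) =
        (\<chi> k. det (\<chi> i j. if j = k then (\<chi> k. Y w $ k $ \<beta>) $ i else P w $ i $ j) / det (P w))"
      using cramer by blast
    from arg_cong[OF this, of "\<lambda>v. v $ k"] show ?thesis by (simp cong: if_cong)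
  qed
  have "(\<lambda>w. ?N w $ i $ j) differentiable (at z)" for i j
    using P Y unfolding mdiff_def by (cases "j = k") simp_all
  then have "mdiff ?N z" by (simp add: mdiff_def)
  moreover have "det (P z) \<noteq> 0" using inv[OF S(2)] by (simp add: invertible_det_nz)
  ultimately have "(\<lambda>w. det (?N w) / det (P w)) differentiable (at z)"
    by (intro differentiable_divide mdiff_det P)
  then show "(\<lambda>w. X w $ k $ \<beta>) differentiable (at z)"
    using entry by (rule differentiable_cong[OF S, rotated])
qed


section \<open>The second derivative test along complex lines\<close>

lemma second_derivative_test:
  fixes f f' :: "real \<Rightarrow> real"
  assumes e: "0 < e" and f: "\<And>t. \<bar>t\<bar> < e \<Longrightarrow> (f has_real_derivative f' t) (at t)"
    and f': "(f' has_real_derivative d) (at 0)" and min: "\<And>t. \<bar>t\<bar> < e \<Longrightarrow> f 0 \<le> f t"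
  shows "0 \<le> d"
proof (rule ccontr)
  assume "\<not> 0 \<le> d"
  then have "d < 0" by simp
  have f0: "f' 0 = 0"
    by (rule DERIV_local_min[OF f[of 0] e]) (use e min in auto)
  obtain b where b: "0 < b" "\<And>h. 0 < h \<Longrightarrow> h < b \<Longrightarrow> f' h < 0"
    using DERIV_neg_dec_right[OF f' \<open>d < 0\<close>] f0 by auto
  define s where "s = min b e / 2"
  have s: "0 < s" "s < b" "s < e" using b(1) e by (auto simp: s_def)
  have "\<exists>t. 0 < t \<and> t < s \<and> f s - f 0 = (s - 0) * f' t"
    by (rule MVT2) (use s f in auto)
  then obtain t where t: "0 < t" "t < s" "f s - f 0 = s * f' t" by auto
  have "f' t < 0" using b(2)[of t] t s by simp
  then have "f s - f 0 < 0" using t(3) s(1) by (simp add: mult_pos_neg)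
  then show False using min[of s] s by simp
qed

text \<open>
  Twice differentiability of a complex-valued function at every point of \<open>S\<close>; continuity of the
  second derivatives is not required.
\<close>

definition twice_diff :: "(complex^'n) set \<Rightarrow> (complex^'n \<Rightarrow> complex) \<Rightarrow> bool" where
  "twice_diff S F \<longleftrightarrow> (\<forall>z\<in>S. F differentiable (at z) \<and>
     (\<forall>v. (\<lambda>w. frechet_derivative F (at w) v) differentiable (at z)))"

lemma Cinf_on_twice_diff: "Cinf_on F S \<Longrightarrow> twice_diff S F"
proof -
  assume "Cinf_on F S"
  then have "Ck_on (Suc (Suc 0)) F S" unfolding Cinf_on_def by blast
  then show ?thesis unfolding twice_diff_def Ck_on.simps by blast
qed

lemma twice_diffD:
  assumes "twice_diff S F" "z \<in> S"
  shows "F differentiable (at z)" "(\<lambda>w. frechet_derivative F (at w) v) differentiable (at z)"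
  using assms by (auto simp: twice_diff_def)

lemma twice_diff_add:
  assumes S: "open S" and F: "twice_diff S F" and G: "twice_diff S G"
  shows "twice_diff S (\<lambda>w. F w + G w)"
  unfolding twice_diff_def
proof (intro ballI conjI allI)
  fix z v assume z: "z \<in> S"
  show "(\<lambda>w. F w + G w) differentiable (at z)"
    using twice_diffD(1)[OF F z] twice_diffD(1)[OF G z] by simp
  have "frechet_derivative F (at w) v + frechet_derivative G (at w) v
      = frechet_derivative (\<lambda>w. F w + G w) (at w) v" if "w \<in> S" for w
    using has_derivative_add[OF twice_diffD(1)[OF F that, unfolded frechet_derivative_works]
      twice_diffD(1)[OF G that, unfolded frechet_derivative_works]]
    by (simp add: frechet_derivative_at[symmetric])
  from differentiable_cong[OF S z this differentiable_add[OF twice_diffD(2)[OF F z] twice_diffD(2)[OF G z]]]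
  show "(\<lambda>w. frechet_derivative (\<lambda>w. F w + G w) (at w) v) differentiable (at z)" .
qed

lemma twice_diff_cmult:
  assumes S: "open S" and F: "twice_diff S F"
  shows "twice_diff S (\<lambda>w. k * F w)"
  unfolding twice_diff_def
proof (intro ballI conjI allI)
  fix z v assume z: "z \<in> S"
  show "(\<lambda>w. k * F w) differentiable (at z)"
    using twice_diffD(1)[OF F z] by simp
  have "k * frechet_derivative F (at w) v = frechet_derivative (\<lambda>w. k * F w) (at w) v" if "w \<in> S" for w
    using has_derivative_mult_right[OF twice_diffD(1)[OF F that, unfolded frechet_derivative_works], of k]
    by (simp add: frechet_derivative_at[symmetric])
  from differentiable_cong[OF S z this differentiable_mult[OF differentiable_const twice_diffD(2)[OF F z]]]
  show "(\<lambda>w. frechet_derivative (\<lambda>w. k * F w) (at w) v) differentiable (at z)" .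
qed

lemma twice_diff_const: "twice_diff S (\<lambda>_. k)"
  by (simp add: twice_diff_def)

lemma twice_diff_sum:
  assumes "open S" "\<And>i. i \<in> I \<Longrightarrow> twice_diff S (F i)"
  shows "twice_diff S (\<lambda>w. \<Sum>i\<in>I. F i w)"
  using assms(2)
  by (induction I rule: infinite_finite_induct) (auto intro: twice_diff_const twice_diff_add[OF assms(1)])

lemma twice_diff_cip:
  assumes S: "open S" and X: "\<And>\<alpha> \<beta>. twice_diff S (\<lambda>w. X w $ \<alpha> $ \<beta>)"
  shows "twice_diff S (\<lambda>w. cip (X w *v x) y)"
proof -
  have "twice_diff S (\<lambda>w. \<Sum>i\<in>UNIV. \<Sum>j\<in>UNIV. (x $ j * cnj (y $ i)) * X w $ i $ j)"
    by (intro twice_diff_sum twice_diff_cmult S X)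
  then show ?thesis by (simp add: cip_mult_expand ac_simps)
qed

lemma twice_diff_mwirt:
  assumes S: "open S" "z \<in> S" and X: "\<And>\<alpha> \<beta>. twice_diff S (\<lambda>w. X w $ \<alpha> $ \<beta>)"
  shows "mdiff X z" "mdiff (mwirt a X) z"
proof -
  show "mdiff X z" using twice_diffD(1)[OF X S(2)] by (simp add: mdiff_def)
  show "mdiff (mwirt a X) z"
    unfolding mdiff_def mwirt_def vec_lambda_beta wirt_def Let_def divide_inverse
    by (cases a; simp only: sum.case; intro allI differentiable_mult differentiable_add differentiable_diff
        differentiable_const twice_diffD(2)[OF X S(2)])
qed

text \<open>
  The second derivative test for \<open>q\<^sub>0 + t q\<^sub>1 + t\<^sup>2 q\<^sub>2\<close> along the real line \<open>z + t d\<close>, with a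
  minimum at \<open>t = 0\<close>. The expansion of \<open>Q(u + t e, u + t e)\<close> for a form \<open>Q\<close> that depends on the
  point has this shape.
\<close>

lemma line_second_derivative:
  fixes q\<^sub>0 q\<^sub>1 q\<^sub>2 :: "complex^'n \<Rightarrow> complex"
  assumes S: "open S" "z \<in> S"
    and q: "twice_diff S q\<^sub>0" "twice_diff S q\<^sub>1" "twice_diff S q\<^sub>2"
    and min: "\<And>t. z + t *\<^sub>R d \<in> S \<Longrightarrow> 0 \<le> Re (q\<^sub>0 (z + t *\<^sub>R d) + t *\<^sub>R q\<^sub>1 (z + t *\<^sub>R d) + t\<^sup>2 *\<^sub>R q\<^sub>2 (z + t *\<^sub>R d))"
    and null: "Re (q\<^sub>0 z) = 0"
  shows "0 \<le> Re (frechet_derivative (\<lambda>w. frechet_derivative q\<^sub>0 (at w) d) (at z) d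
    + 2 * frechet_derivative q\<^sub>1 (at z) d + 2 * q\<^sub>2 z)"
proof -
  let ?c = "\<lambda>t. z + t *\<^sub>R d"
  have "continuous_on UNIV ?c" by (intro continuous_intros)
  then have op: "open (?c -` S)" using S(1) open_vimage by blast
  have "0 \<in> ?c -` S" using S(2) by simp
  then obtain e where "0 < e" "\<forall>t. dist t 0 < e \<longrightarrow> t \<in> ?c -` S"
    using op unfolding open_dist by blast
  then have e: "0 < e" "\<And>t. \<bar>t\<bar> < e \<Longrightarrow> ?c t \<in> S" by simp_all
  have line: "((\<lambda>t. Re (F (?c t))) has_real_derivative Re (frechet_derivative F (at (?c t)) d)) (at t)"
    if "F differentiable (at (?c t))" for F :: "complex^'n \<Rightarrow> complex" and t :: real
  proof -
    have lin: "linear (frechet_derivative F (at (?c t)))"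
      using that has_derivative_linear frechet_derivative_works by blast
    have "(?c has_derivative (\<lambda>s. s *\<^sub>R d)) (at t)"
      by (auto intro!: derivative_eq_intros)
    moreover have "(F has_derivative frechet_derivative F (at (?c t))) (at (?c t))"
      using that by (simp add: frechet_derivative_works)
    ultimately have "((\<lambda>t. F (?c t)) has_derivative (\<lambda>s. frechet_derivative F (at (?c t)) (s *\<^sub>R d))) (at t)"
      by (rule has_derivative_compose)
    then have "((\<lambda>t. Re (F (?c t))) has_derivative (\<lambda>s. Re (frechet_derivative F (at (?c t)) (s *\<^sub>R d)))) (at t)"
      by (rule has_derivative_Re)
    then show ?thesis
      unfolding has_field_derivative_def by (simp add: linear_scale[OF lin] mult_commute_abs)
  qed
  define D where "D F w = frechet_derivative F (at w) d" for F :: "complex^'n \<Rightarrow> complex" and w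
  note line = line[folded D_def]
  have d1: "F differentiable (at (?c t))" "D F differentiable (at (?c t))" if "twice_diff S F" "\<bar>t\<bar> < e" for F t
    using twice_diffD[OF that(1) e(2)[OF that(2)]] unfolding D_def[abs_def] by auto
  let ?f = "\<lambda>t. Re (q\<^sub>0 (?c t)) + t * Re (q\<^sub>1 (?c t)) + t\<^sup>2 * Re (q\<^sub>2 (?c t))"
  let ?f' = "\<lambda>t. Re (D q\<^sub>0 (?c t)) + (Re (q\<^sub>1 (?c t)) + t * Re (D q\<^sub>1 (?c t)))
    + (2 * t * Re (q\<^sub>2 (?c t)) + t\<^sup>2 * Re (D q\<^sub>2 (?c t)))"
  have "0 \<le> Re (D (D q\<^sub>0) z) + (Re (D q\<^sub>1 z) + Re (D q\<^sub>1 z)) + 2 * Re (q\<^sub>2 z)"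
  proof (rule second_derivative_test[OF e(1), of ?f ?f'])
    show "(?f has_real_derivative ?f' t) (at t)" if "\<bar>t\<bar> < e" for t
    proof -
      note l = line[OF d1(1)[OF q(1) that]] line[OF d1(1)[OF q(2) that]] line[OF d1(1)[OF q(3) that]]
      show ?thesis
        by (rule DERIV_cong[OF DERIV_add[OF DERIV_add[OF l(1) DERIV_mult[OF DERIV_ident l(2)]]
              DERIV_mult[OF DERIV_power[OF DERIV_ident, of 2] l(3)]]]) simp
    qed
    have 0: "\<bar>0\<bar> < e" using e(1) by simp
    note l = line[OF d1(1)[OF q(2) 0]] line[OF d1(1)[OF q(3) 0]]
      line[OF d1(2)[OF q(1) 0]] line[OF d1(2)[OF q(2) 0]] line[OF d1(2)[OF q(3) 0]]
    show "(?f' has_real_derivative Re (D (D q\<^sub>0) z) + (Re (D q\<^sub>1 z) + Re (D q\<^sub>1 z)) + 2 * Re (q\<^sub>2 z)) (at 0)"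
      by (rule DERIV_cong[OF DERIV_add[OF DERIV_add[OF l(3) DERIV_add[OF l(1) DERIV_mult[OF DERIV_ident l(4)]]]
            DERIV_add[OF DERIV_mult[OF DERIV_cmult[OF DERIV_ident, of 2] l(2)]
              DERIV_mult[OF DERIV_power[OF DERIV_ident, of 2] l(5)]]]]) simp
    show "?f 0 \<le> ?f t" if "\<bar>t\<bar> < e" for t
      using min[OF e(2)[OF that]] null by simp
  qed
  then show ?thesis unfolding D_def[abs_def] by simp
qed

text \<open>
  At a zero of a positive semidefinite family of Hermitian forms, the Levi form of
  \<open>Q(v, v)\<close> is nonnegative, where \<open>v = u + t w\<close> along the complex line \<open>z + t a\<close>. Four times
  the Levi form is the sum of the second derivatives in the real directions \<open>a\<close> and \<open>\<i> a\<close>.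
\<close>

lemma levi_nonneg:
  fixes Q :: "complex^'n \<Rightarrow> complex^'r^'r"
  assumes S: "open S" "z \<in> S"
    and Q: "\<And>\<alpha> \<beta>. twice_diff S (\<lambda>w. Q w $ \<alpha> $ \<beta>)"
    and herm: "\<And>w. w \<in> S \<Longrightarrow> adj (Q w) = Q w"
    and psd: "\<And>w v. w \<in> S \<Longrightarrow> 0 \<le> Re (cip (Q w *v v) v)"
    and null: "Re (cip (Q z *v u) u) = 0"
  shows "0 \<le> Re ((\<Sum>i\<in>UNIV. \<Sum>j\<in>UNIV. a $ i * cnj (a $ j) * cip (mwirt (Inr j) (mwirt (Inl i) Q) z *v u) u)
    + 2 * (\<Sum>i\<in>UNIV. a $ i * cip (mwirt (Inl i) Q z *v u) w) + cip (Q z *v w) w)"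
proof -
  define q where "q x y = (\<lambda>w. cip (Q w *v x) y)" for x y
  define D where "D x y d = (\<lambda>w. frechet_derivative (q x y) (at w) d)" for x y d
  define DD where "DD d e = frechet_derivative (D u u d) (at z) e" for d e
  have q2: "twice_diff S (q x y)" for x y
    unfolding q_def by (rule twice_diff_cip[OF S(1) Q])
  note qd = twice_diffD(1)[OF q2]
  have Dd: "D x y d differentiable (at w)" if "w \<in> S" for x y d w
    unfolding D_def by (rule twice_diffD(2)[OF q2 that])
  have md: "mdiff Q w" "mdiff (mwirt b Q) w" if "w \<in> S" for b w
    using twice_diff_mwirt[OF S(1) that Q] .
  have D_cnj: "D x y d w = cnj (D y x d w)" if "w \<in> S" for x y d w
  proof -
    have "frechet_derivative (q x y) (at w) = frechet_derivative (\<lambda>w. cnj (q y x w)) (at w)"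
      by (rule frechet_derivative_cong[OF S(1) that]) (simp only: q_def, rule hermitian_cip[OF herm])
    then show ?thesis unfolding D_def by (simp add: frechet_derivative_cnj[OF qd[OF that]])
  qed
  have DD_real: "Im (DD d e) = 0" for d e
  proof -
    have "frechet_derivative (D u u d) (at z) = frechet_derivative (\<lambda>w. cnj (D u u d w)) (at z)"
      by (rule frechet_derivative_cong[OF S]) (rule D_cnj)
    from fun_cong[OF this, of e] have "DD d e = cnj (DD d e)"
      unfolding DD_def frechet_derivative_cnj[OF Dd[OF S(2)]] .
    from arg_cong[OF this, of Im] show ?thesis by simp
  qed
  have line: "0 \<le> Re (DD d d) + 4 * Re (D u e d z) + 2 * Re (q e e z)" for d e
  proof -
    have "0 \<le> Re (frechet_derivative (D u u d) (at z) d
      + 2 * frechet_derivative (\<lambda>w. q u e w + q e u w) (at z) d + 2 * q e e z)"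
      unfolding D_def
    proof (rule line_second_derivative[OF S q2 twice_diff_add[OF S(1) q2 q2] q2])
      show "Re (q u u z) = 0" using null by (simp add: q_def)
      fix t assume "z + t *\<^sub>R d \<in> S"
      from psd[OF this, of "u + complex_of_real t *s e"]
      show "0 \<le> Re (q u u (z + t *\<^sub>R d) + t *\<^sub>R (q u e (z + t *\<^sub>R d) + q e u (z + t *\<^sub>R d))
        + t\<^sup>2 *\<^sub>R q e e (z + t *\<^sub>R d))"
        by (simp add: q_def matrix_vector_right_distrib vector_scalar_commute cip_add_left cip_add_right
            cip_scale_left cip_scale_right power2_eq_square algebra_simps)
    qed
    moreover have "frechet_derivative (\<lambda>w. q u e w + q e u w) (at z) d = D u e d z + D e u d z"
      unfolding D_def
      by (simp add: frechet_derivative_at[OF has_derivative_add[OF qd[OF S(2), unfolded frechet_derivative_works]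
        qd[OF S(2), unfolded frechet_derivative_works]], symmetric])
    ultimately show ?thesis
      using D_cnj[OF S(2), of e u d] unfolding DD_def by simp
  qed
  have scale: "D u (\<i> *s w) d z = - \<i> * D u w d z" for d
  proof -
    have e: "q u (\<i> *s w) = (\<lambda>x. - \<i> * q u w x)" by (simp add: q_def cip_scale_right fun_eq_iff)
    have "frechet_derivative (\<lambda>x. - \<i> * q u w x) (at z) = (\<lambda>d. - \<i> * frechet_derivative (q u w) (at z) d)"
      by (rule frechet_derivative_at[symmetric, OF has_derivative_mult_right[OF qd[OF S(2), unfolded frechet_derivative_works]]])
    then show ?thesis unfolding D_def e by simp
  qed
  have "0 \<le> Re (DD a a) + 4 * Re (D u w a z) + 2 * Re (q w w z)" by (rule line)
  moreover have "0 \<le> Re (DD (\<i> *s a) (\<i> *s a)) + 4 * Im (D u w (\<i> *s a) z) + 2 * Re (q w w z)"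
    using line[of "\<i> *s a" "\<i> *s w"] unfolding scale
    by (simp add: q_def vector_scalar_commute cip_scale_left cip_scale_right)
  moreover have first: "(\<Sum>i\<in>UNIV. a $ i * cip (mwirt (Inl i) Q z *v u) w) = (D u w a z - \<i> * D u w (\<i> *s a) z) / 2"
    using wirt_direction(1)[OF qd[OF S(2)], of a u w] unfolding q_def D_def
    by (simp only: wirt_cip[OF md(1)[OF S(2)]])
  moreover have second: "(\<Sum>i\<in>UNIV. \<Sum>j\<in>UNIV. a $ i * cnj (a $ j) * cip (mwirt (Inr j) (mwirt (Inl i) Q) z *v u) u) =
    (DD a a - \<i> * DD (\<i> *s a) a + \<i> * (DD a (\<i> *s a) - \<i> * DD (\<i> *s a) (\<i> *s a))) / 4"
  proof -
    define g where "g = (\<lambda>w. \<Sum>i\<in>UNIV. a $ i * cip (mwirt (Inl i) Q w *v u) u)"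
    have gd: "(\<lambda>w. cip (mwirt (Inl i) Q w *v u) u) differentiable (at z)" for i
      using md(2)[OF S(2)] unfolding cip_mult_expand mdiff_def by simp
    have "(D u u a w - \<i> * D u u (\<i> *s a) w) / 2 = g w" if "w \<in> S" for w
      using wirt_direction(1)[OF qd[OF that], of a u u] unfolding q_def D_def g_def
      by (simp only: wirt_cip[OF md(1)[OF that]])
    note g_eq = this
    have "((\<lambda>w. (D u u a w - \<i> * D u u (\<i> *s a) w) / 2) has_derivative
      (\<lambda>v. (DD a v - \<i> * DD (\<i> *s a) v) / 2)) (at z)"
      unfolding DD_def
      by (intro bounded_linear.has_derivative[OF bounded_linear_divide] has_derivative_diff has_derivative_mult_right
          Dd[OF S(2), unfolded frechet_derivative_works])
    then have g': "(g has_derivative (\<lambda>v. (DD a v - \<i> * DD (\<i> *s a) v) / 2)) (at z)"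
      by (rule has_derivative_transform_within_open[OF _ S]) (rule g_eq)
    have "(\<Sum>i\<in>UNIV. \<Sum>j\<in>UNIV. a $ i * cnj (a $ j) * cip (mwirt (Inr j) (mwirt (Inl i) Q) z *v u) u) =
      (\<Sum>j\<in>UNIV. cnj (a $ j) * (\<Sum>i\<in>UNIV. a $ i * cip (mwirt (Inr j) (mwirt (Inl i) Q) z *v u) u))"
      by (subst sum.swap) (simp add: sum_distrib_left ac_simps)
    also have "\<dots> = (\<Sum>j\<in>UNIV. cnj (a $ j) * wirt (Inr j) g z)"
      unfolding g_def
      by (simp add: wirt_sum wirt_mult gd wirt_cip[OF md(2)[OF S(2)]])
    also have "\<dots> = (DD a a - \<i> * DD (\<i> *s a) a + \<i> * (DD a (\<i> *s a) - \<i> * DD (\<i> *s a) (\<i> *s a))) / 4"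
      unfolding wirt_direction(2)[OF differentiableI[OF g']] frechet_derivative_at[OF g', symmetric]
      by (simp add: field_simps)
    finally show ?thesis .
  qed
  ultimately show ?thesis unfolding first second by (simp add: q_def DD_real field_simps)
qed


section \<open>The curvature of the Higgs connection of a local metric\<close>

text \<open>
  A Hermitian metric in a holomorphic frame over an open set of coordinate space, together with a
  Higgs field. The metric \<open>h\<close> is given by the matrix \<open>P\<close> with \<open>h(v, w) = cip (P v) w\<close>, i.e. by the
  transpose of the matrix of values of \<open>h\<close> on the frame. The matrices \<open>\<Gamma> i\<close> are those
  of the (1,0)-part of the Chern connection, whose (0,1)-part vanishes in a holomorphic frame,
  \<open>T i\<close> those of the Higgs field and \<open>Ts j\<close> those of its adjoint.
\<close>

locale local_higgs_metric =
  fixes S :: "(complex^'n) set" and z :: "complex^'n" and P :: "complex^'n \<Rightarrow> complex^'r^'r"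
    and \<Gamma> T Ts :: "'n \<Rightarrow> complex^'n \<Rightarrow> complex^'r^'r"
  assumes S: "open S" "z \<in> S"
    and P_smooth: "\<And>\<alpha> \<beta>. twice_diff S (\<lambda>w. P w $ \<alpha> $ \<beta>)"
    and P_herm: "\<And>w. w \<in> S \<Longrightarrow> adj (P w) = P w"
    and P_pos: "\<And>w. w \<in> S \<Longrightarrow> posdef (P w)"
    and T_diff: "\<And>i. mdiff (T i) z"
    and T_holo: "\<And>i j. mwirt (Inr j) (T i) z = 0"
    and chern: "\<And>i w. w \<in> S \<Longrightarrow> P w ** \<Gamma> i w = mwirt (Inl i) P w"
    and adjoint: "\<And>j w. w \<in> S \<Longrightarrow> P w ** Ts j w = adj (T j w) ** P w"
begin

lemma P_mdiff: "w \<in> S \<Longrightarrow> mdiff P w" "w \<in> S \<Longrightarrow> mdiff (mwirt a P) w"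
  using twice_diff_mwirt[OF S(1) _ P_smooth] by blast+

lemma \<Gamma>_diff: "mdiff (\<Gamma> i) z"
  by (rule mdiff_solution[OF S chern posdef_invertible[OF P_pos] P_mdiff(1)[OF S(2)] P_mdiff(2)[OF S(2)]])

lemma adj_T_diff: "mdiff (\<lambda>w. adj (T j w)) z"
  and mwirt_adj_T: "mwirt (Inl i) (\<lambda>w. adj (T j w)) z = 0"
  using mwirt_adj(1)[OF T_diff[of j], of "Inr i"] mwirt_adj(2)[OF T_diff[of j]] T_holo[of i j] by (simp_all add: adj_def vec_eq_iff)

lemma Ts_diff: "mdiff (Ts j) z"
  by (rule mdiff_solution[OF S adjoint posdef_invertible[OF P_pos] P_mdiff(1)[OF S(2)]
        mdiff_mult[OF adj_T_diff P_mdiff(1)[OF S(2)]]])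

text \<open>
  The matrix of the mixed component of the curvature of the Higgs connection at \<open>z\<close>, the one along
  \<open>dz\<^sup>i\<close> and the conjugate of \<open>dz\<^sup>j\<close>.
\<close>

definition F :: "'n \<Rightarrow> 'n \<Rightarrow> complex^'r^'r" where
  "F i j = mwirt (Inl i) (Ts j) z + (\<Gamma> i z + T i z) ** Ts j z
     - mwirt (Inr j) (\<lambda>w. \<Gamma> i w + T i w) z - Ts j z ** (\<Gamma> i z + T i z)"

text \<open>
  The derivative of the adjoint field cancels against its commutator with \<open>\<Gamma>\<close>, since the adjoint
  of a holomorphic field is parallel in the holomorphic directions. There remain the curvature of
  the Chern connection and the commutator of the Higgs field with its adjoint.
\<close>

lemma lowered_curvature:
  "P z ** F i j = - mwirt (Inr j) (mwirt (Inl i) P) z + adj (\<Gamma> j z) ** (P z ** \<Gamma> i z)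
     + adj (Ts i z) ** (P z ** Ts j z) - adj (T j z) ** (P z ** T i z)"
proof -
  note Pd = P_mdiff(1)[OF S(2)]
  have adj\<Gamma>: "mwirt (Inr j) P z = adj (\<Gamma> j z) ** P z"
  proof -
    have "mwirt (Inr j) P z = mwirt (bar (Inl j)) (\<lambda>w. adj (P w)) z"
      using mwirt_cong[OF S, of P "\<lambda>w. adj (P w)" "Inr j"] P_herm by simp
    also have "\<dots> = adj (P z ** \<Gamma> j z)"
      using mwirt_adj(1)[OF Pd, of "Inl j"] chern[OF S(2)] by simp
    finally show ?thesis using P_herm[OF S(2)] by (simp add: adj_mult)
  qed
  have "mwirt (Inl i) (\<lambda>w. P w ** Ts j w) z = mwirt (Inl i) (\<lambda>w. adj (T j w) ** P w) z"
    by (rule mwirt_cong[OF S adjoint])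
  then have 1: "P z ** mwirt (Inl i) (Ts j) z
      = adj (T j z) ** (P z ** \<Gamma> i z) - P z ** \<Gamma> i z ** Ts j z"
    using chern[OF S(2)] by (simp add: mwirt_mult Pd Ts_diff adj_T_diff mwirt_adj_T algebra_simps)
  have "mwirt (Inr j) (\<lambda>w. P w ** \<Gamma> i w) z = mwirt (Inr j) (mwirt (Inl i) P) z"
    by (rule mwirt_cong[OF S chern])
  then have 2: "P z ** mwirt (Inr j) (\<Gamma> i) z
      = mwirt (Inr j) (mwirt (Inl i) P) z - adj (\<Gamma> j z) ** (P z ** \<Gamma> i z)"
    by (simp add: mwirt_mult Pd \<Gamma>_diff adj\<Gamma> matrix_mul_assoc algebra_simps)
  have 3: "adj (Ts i z) ** P z = P z ** T i z"
    using arg_cong[OF adjoint[OF S(2), of i], of adj] P_herm[OF S(2)] by (simp add: adj_mult)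
  have "P z ** F i j = P z ** mwirt (Inl i) (Ts j) z + P z ** (\<Gamma> i z ** Ts j z) + P z ** (T i z ** Ts j z)
      - P z ** mwirt (Inr j) (\<Gamma> i) z - P z ** Ts j z ** \<Gamma> i z - P z ** Ts j z ** T i z"
    unfolding F_def mwirt_add[OF \<Gamma>_diff T_diff] T_holo
    by (simp add: matrix_mult_distribs matrix_mul_assoc algebra_simps)
  also have "P z ** (T i z ** Ts j z) = adj (Ts i z) ** (P z ** Ts j z)"
    by (simp add: matrix_mul_assoc 3)
  finally show ?thesis
    unfolding 1 2 adjoint[OF S(2), of j] by (simp add: matrix_mul_assoc algebra_simps)
qed

text \<open>The value of the lowered curvature contracted with a direction \<open>a\<close> on a vector \<open>u\<close>.\<close>

lemma curvature_direction:
  "(\<Sum>i\<in>UNIV. \<Sum>j\<in>UNIV. a $ i * cnj (a $ j) * cip ((P z ** F i j) *v u) u) =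
    - (\<Sum>i\<in>UNIV. \<Sum>j\<in>UNIV. a $ i * cnj (a $ j) * cip (mwirt (Inr j) (mwirt (Inl i) P) z *v u) u)
    + cip (P z *v (\<Sum>i\<in>UNIV. a $ i *s (\<Gamma> i z *v u))) (\<Sum>i\<in>UNIV. a $ i *s (\<Gamma> i z *v u))
    + cip (P z *v (\<Sum>i\<in>UNIV. cnj (a $ i) *s (Ts i z *v u))) (\<Sum>i\<in>UNIV. cnj (a $ i) *s (Ts i z *v u))
    - cip (P z *v (\<Sum>i\<in>UNIV. a $ i *s (T i z *v u))) (\<Sum>i\<in>UNIV. a $ i *s (T i z *v u))"
proof -
  have sesq: "cip (P z *v (\<Sum>i\<in>UNIV. b i *s x i)) (\<Sum>i\<in>UNIV. c i *s y i) =
    (\<Sum>i\<in>UNIV. \<Sum>j\<in>UNIV. b i * cnj (c j) * cip (P z *v x i) (y j))" for b c :: "'n \<Rightarrow> complex" and x y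
    unfolding matrix_vector_mult_sum_right vector_scalar_commute cip_sum_left cip_scale_left
    unfolding cip_sum_right cip_scale_right sum_distrib_left by (simp only: mult.assoc)
  have adjc: "cip ((adj A ** B) *v u) u = cip (B *v u) (A *v u)" for A B :: "complex^'r^'r"
    by (metis adj_adj cip_adj matrix_vector_mul_assoc)
  have e: "cip ((P z ** F i j) *v u) u = - cip (mwirt (Inr j) (mwirt (Inl i) P) z *v u) u
     + cip (P z *v (\<Gamma> i z *v u)) (\<Gamma> j z *v u) + cip (P z *v (Ts j z *v u)) (Ts i z *v u)
     - cip (P z *v (T i z *v u)) (T j z *v u)" for i j
    unfolding lowered_curvature matrix_vector_mult_add_rdistrib matrix_vector_mult_diff_rdistrib
      cip_add_left cip_diff_left adjc matrix_vector_mult_minus_left cip_minus_left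
    by (simp add: matrix_vector_mul_assoc)
  show ?thesis
    unfolding e sesq
      sum.swap[of "\<lambda>i j. cnj (a $ i) * cnj (cnj (a $ j)) * cip (P z *v (Ts i z *v u)) (Ts j z *v u)"]
    by (simp add: sum.distrib sum_subtractf sum_negf algebra_simps)
qed

end

text \<open>
  The pointwise core of the maximum principle. If \<open>l h\<^sub>0 - h \<ge> 0\<close> near \<open>z\<close> with null vector \<open>u\<close> at
  \<open>z\<close>, then the lowered Higgs curvature of \<open>h\<close> dominates \<open>l\<close> times that of \<open>h\<^sub>0\<close> on \<open>u\<close>, in
  every direction \<open>a\<close>.
\<close>

lemma curvature_comparison:
  fixes P :: "complex^'n \<Rightarrow> complex^'r^'r"
  assumes "local_higgs_metric S z P \<Gamma> T Ts" and "local_higgs_metric S z P\<^sub>0 \<Gamma>\<^sub>0 T Ts\<^sub>0"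
    and dom: "\<And>w v. w \<in> S \<Longrightarrow> Re (cip (P w *v v) v) \<le> l * Re (cip (P\<^sub>0 w *v v) v)"
    and null: "Re (cip (P z *v u) u) = l * Re (cip (P\<^sub>0 z *v u) u)"
  shows "0 \<le> Re (\<Sum>i\<in>UNIV. \<Sum>j\<in>UNIV. a $ i * cnj (a $ j) *
    (cip ((P z ** local_higgs_metric.F z \<Gamma> T Ts i j) *v u) u
      - l * cip ((P\<^sub>0 z ** local_higgs_metric.F z \<Gamma>\<^sub>0 T Ts\<^sub>0 i j) *v u) u))"
proof -
  interpret h: local_higgs_metric S z P \<Gamma> T Ts by fact
  interpret h0: local_higgs_metric S z P\<^sub>0 \<Gamma>\<^sub>0 T Ts\<^sub>0 by fact
  note S = h.S
  let ?c = "\<lambda>v w. cip (P z *v v) w" and ?d = "\<lambda>v w. cip (P\<^sub>0 z *v v) w"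
  define Q where "Q w = l *\<^sub>R P\<^sub>0 w - P w" for w
  define g where "g = (\<Sum>i\<in>UNIV. a $ i *s (\<Gamma> i z *v u))"
  define g0 where "g0 = (\<Sum>i\<in>UNIV. a $ i *s (\<Gamma>\<^sub>0 i z *v u))"
  define s where "s = (\<Sum>i\<in>UNIV. cnj (a $ i) *s (Ts i z *v u))"
  define s0 where "s0 = (\<Sum>i\<in>UNIV. cnj (a $ i) *s (Ts\<^sub>0 i z *v u))"
  define t where "t = (\<Sum>i\<in>UNIV. a $ i *s (T i z *v u))"
  define L where "L = (\<Sum>i\<in>UNIV. \<Sum>j\<in>UNIV. a $ i * cnj (a $ j) * cip (mwirt (Inr j) (mwirt (Inl i) P) z *v u) u)"
  define L0 where "L0 = (\<Sum>i\<in>UNIV. \<Sum>j\<in>UNIV. a $ i * cnj (a $ j) * cip (mwirt (Inr j) (mwirt (Inl i) P\<^sub>0) z *v u) u)"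
  have smooth: "twice_diff S (\<lambda>w. Q w $ \<alpha> $ \<beta>)" for \<alpha> \<beta>
  proof -
    have "twice_diff S (\<lambda>w. complex_of_real l * P\<^sub>0 w $ \<alpha> $ \<beta> + (-1) * P w $ \<alpha> $ \<beta>)"
      by (intro twice_diff_add twice_diff_cmult S h.P_smooth h0.P_smooth)
    then show ?thesis unfolding Q_def by (simp add: scaleR_conv_of_real[where 'a=complex])
  qed
  have herm: "adj (Q w) = Q w" if "w \<in> S" for w
    unfolding Q_def adj_scaled_diff by (simp add: h.P_herm h0.P_herm that)
  have psd: "0 \<le> Re (cip (Q w *v v) v)" if "w \<in> S" for w v
    using dom[OF that, of v] unfolding Q_def cip_scaled_diff by simp
  have Qnull: "Re (cip (Q z *v u) u) = 0"
    using null unfolding Q_def cip_scaled_diff by simp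
  have md: "mwirt b Q w = l *\<^sub>R mwirt b P\<^sub>0 w - mwirt b P w" if "w \<in> S" for b w
  proof -
    have "(\<lambda>w. P\<^sub>0 w $ \<alpha> $ \<beta>) differentiable (at w)" "(\<lambda>w. P w $ \<alpha> $ \<beta>) differentiable (at w)" for \<alpha> \<beta>
      using h.P_mdiff(1)[OF that] h0.P_mdiff(1)[OF that] by (simp_all add: mdiff_def)
    then show ?thesis
      unfolding mwirt_def Q_def
      by (simp add: vec_eq_iff wirt_diff wirt_mult scaleR_conv_of_real[where 'a=complex])
  qed
  have mdd: "mwirt (Inr j) (mwirt (Inl i) Q) z
      = l *\<^sub>R mwirt (Inr j) (mwirt (Inl i) P\<^sub>0) z - mwirt (Inr j) (mwirt (Inl i) P) z" for i j
  proof -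
    have d: "(\<lambda>w. mwirt (Inl i) P\<^sub>0 w $ \<alpha> $ \<beta>) differentiable (at z)" "(\<lambda>w. mwirt (Inl i) P w $ \<alpha> $ \<beta>) differentiable (at z)" for \<alpha> \<beta>
      using h.P_mdiff(2)[OF S(2), of "Inl i"] h0.P_mdiff(2)[OF S(2), of "Inl i"] by (simp_all add: mdiff_def)
    have "mwirt (Inr j) (mwirt (Inl i) Q) z = mwirt (Inr j) (\<lambda>w. l *\<^sub>R mwirt (Inl i) P\<^sub>0 w - mwirt (Inl i) P w) z"
      by (rule mwirt_cong[OF S md])
    also have "\<dots> = l *\<^sub>R mwirt (Inr j) (mwirt (Inl i) P\<^sub>0) z - mwirt (Inr j) (mwirt (Inl i) P) z"
      using d unfolding mwirt_def[of "Inr j"]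
      by (simp add: vec_eq_iff wirt_diff wirt_mult scaleR_conv_of_real[where 'a=complex])
    finally show ?thesis .
  qed
  \<comment> \<open>the first-order variation of \<open>u\<close> is the one that is parallel for \<open>h\<^sub>0\<close>\<close>
  have "0 \<le> Re ((\<Sum>i\<in>UNIV. \<Sum>j\<in>UNIV. a $ i * cnj (a $ j) * cip (mwirt (Inr j) (mwirt (Inl i) Q) z *v u) u)
    + 2 * (\<Sum>i\<in>UNIV. a $ i * cip (mwirt (Inl i) Q z *v u) (- g0)) + cip (Q z *v (- g0)) (- g0))"
    by (rule levi_nonneg[OF S smooth herm psd Qnull])
  also have "(\<Sum>i\<in>UNIV. \<Sum>j\<in>UNIV. a $ i * cnj (a $ j) * cip (mwirt (Inr j) (mwirt (Inl i) Q) z *v u) u) = l * L0 - L"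
    unfolding mdd cip_scaled_diff L_def L0_def
    by (simp add: sum_subtractf sum_distrib_left algebra_simps scaleR_conv_of_real)
  also have "(\<Sum>i\<in>UNIV. a $ i * cip (mwirt (Inl i) Q z *v u) (- g0)) = - (l * ?d g0 g0) + ?c g g0"
  proof -
    have "?c g g0 = (\<Sum>i\<in>UNIV. a $ i * cip (mwirt (Inl i) P z *v u) g0)"
      unfolding g_def by (simp add: matrix_vector_mult_sum_right vector_scalar_commute cip_sum_left cip_scale_left
        matrix_vector_mul_assoc h.chern[OF S(2)])
    moreover have "?d g0 g0 = (\<Sum>i\<in>UNIV. a $ i * cip (mwirt (Inl i) P\<^sub>0 z *v u) g0)"
      by (subst (1) g0_def) (simp add: matrix_vector_mult_sum_right vector_scalar_commute cip_sum_left cip_scale_left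
        matrix_vector_mul_assoc h0.chern[OF S(2)])
    ultimately show ?thesis
      unfolding md[OF S(2)] cip_scaled_diff
      by (simp add: cip_minus_right sum_subtractf sum_distrib_left sum_negf algebra_simps scaleR_conv_of_real)
  qed
  also have "cip (Q z *v (- g0)) (- g0) = l * ?d g0 g0 - ?c g0 g0"
    unfolding Q_def cip_scaled_diff by (simp add: matrix_vector_mult_minus_right cip_minus_left cip_minus_right scaleR_conv_of_real)
  finally have levi: "0 \<le> l * Re L0 - Re L - l * Re (?d g0 g0) + 2 * Re (?c g g0) - Re (?c g0 g0)" by simp
  have c_diff: "0 \<le> Re (?c v v) - 2 * Re (?c v w) + Re (?c w w)" for v w
  proof -
    have "0 \<le> Re (?c (v - w) (v - w))" by (rule posdefD_ge[OF h.P_pos[OF S(2)]])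
    moreover have "Re (?c w v) = Re (?c v w)"
      using hermitian_cip[OF h.P_herm[OF S(2)], of w v] by simp
    ultimately show ?thesis
      by (simp add: matrix_vector_mult_diff_distrib cip_diff_left cip_diff_right)
  qed
  have s: "P z *v s = l *\<^sub>R (P\<^sub>0 z *v s0)"
  proof -
    have "Q z *v u = 0"
      by (rule semidefinite_null_kernel[OF herm[OF S(2)] psd[OF S(2)]]) (simp add: Qnull)
    then have u: "P z *v u = complex_of_real l *s (P\<^sub>0 z *v u)"
      unfolding Q_def matrix_vector_mult_diff_rdistrib
      by (simp add: vec_eq_iff matrix_vector_mult_def sum_distrib_left scaleR_conv_of_real[where 'a=complex] ac_simps)
    have "P z *v s = (\<Sum>i\<in>UNIV. cnj (a $ i) *s (adj (T i z) *v (P z *v u)))"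
      unfolding s_def by (simp add: matrix_vector_mult_sum_right vector_scalar_commute matrix_vector_mul_assoc h.adjoint[OF S(2)])
    also have "\<dots> = complex_of_real l *s (\<Sum>i\<in>UNIV. cnj (a $ i) *s (adj (T i z) *v (P\<^sub>0 z *v u)))"
      unfolding u by (simp add: vector_scalar_commute vec_eq_iff sum_distrib_left ac_simps)
    also have "(\<Sum>i\<in>UNIV. cnj (a $ i) *s (adj (T i z) *v (P\<^sub>0 z *v u))) = P\<^sub>0 z *v s0"
      unfolding s0_def by (simp add: matrix_vector_mult_sum_right vector_scalar_commute matrix_vector_mul_assoc h0.adjoint[OF S(2)])
    also have "complex_of_real l *s (P\<^sub>0 z *v s0) = l *\<^sub>R (P\<^sub>0 z *v s0)"
      by (simp add: vec_eq_iff scaleR_conv_of_real[where 'a=complex])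
    finally show ?thesis .
  qed
  \<comment> \<open>the adjoint terms: expand \<open>h(s - s\<^sub>0, s - s\<^sub>0) \<ge> 0\<close> using \<open>h(s, s\<^sub>0) = l h\<^sub>0(s\<^sub>0, s\<^sub>0)\<close>\<close>
  have "Re (?c s s0) = l * Re (?d s0 s0)"
    unfolding s by (simp add: cip_def sum_distrib_left algebra_simps)
  then have "0 \<le> Re (?c s s) - l * Re (?d s0 s0)"
    using c_diff[of s s0] dom[OF S(2), of s0] by linarith
  moreover have "0 \<le> l * Re (?d t t) - Re (?c t t)" using dom[OF S(2), of t] by simp
  ultimately have "0 \<le> (- Re L + Re (?c g g) + Re (?c s s) - Re (?c t t))
      - l * (- Re L0 + Re (?d g0 g0) + Re (?d s0 s0) - Re (?d t t))"
    using levi c_diff[of g g0] by (simp add: algebra_simps)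
  also have "\<dots> = Re ((- L + ?c g g + ?c s s - ?c t t) - l * (- L0 + ?d g0 g0 + ?d s0 s0 - ?d t t))" by simp
  also have "(- L + ?c g g + ?c s s - ?c t t) - l * (- L0 + ?d g0 g0 + ?d s0 s0 - ?d t t) =
    (\<Sum>i\<in>UNIV. \<Sum>j\<in>UNIV. a $ i * cnj (a $ j) * (cip ((P z ** h.F i j) *v u) u - l * cip ((P\<^sub>0 z ** h0.F i j) *v u) u))"
    unfolding L_def L0_def g_def g0_def s_def s0_def t_def h.curvature_direction[symmetric] h0.curvature_direction[symmetric]
    by (simp add: sum_subtractf sum_distrib_left algebra_simps)
  finally show ?thesis .
qed


section \<open>Metrics on bundles in a chart and a holomorphic frame\<close>

text \<open>
  A Hermitian metric \<open>h\<close> on a holomorphic bundle, together with a chart \<open>c\<close> and a trivialisation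
  \<open>t\<close>. The image of their common domain in coordinate space is \<open>S\<close>, and \<open>point\<close> is the inverse of
  the chart.
\<close>

locale metric_in_frame =
  fixes M :: "'m topology" and \<A> :: "('m, 'n::finite) chart set" and E :: "'m \<Rightarrow> 'e set"
    and \<T> :: "('m, 'e, 'r::finite) triv set" and h :: "('m, 'e) form"
    and c :: "('m, 'n) chart" and t :: "('m, 'e, 'r) triv"
  assumes manifold: "complex_manifold M \<A>" and vbundle: "holomorphic_vector_bundle M \<A> E \<T>"
    and metric: "hermitian_bundle_metric M \<A> E \<T> h" and c: "c \<in> \<A>" and t: "t \<in> \<T>"
begin

definition S :: "(complex^'n) set" where "S = snd c ` (fst c \<inter> fst t)"

definition point :: "complex^'n \<Rightarrow> 'm" where "point = inv_into (fst c) (snd c)"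

text \<open>
  The matrix of the metric, with \<open>h(u, v) = cip (P u) v\<close> in components. It is the transpose of the
  matrix of values of \<open>h\<close> on the frame, so that \<open>P\<close> is multiplied with endomorphisms in the usual
  order.
\<close>

definition P :: "'m \<Rightarrow> complex^'r^'r" where "P y = transpose (form_matrix E t h y)"

lemma chart:
  shows chart_open: "openin M (fst c)" and "open (snd c ` fst c)"
    and chart_homeo: "homeomorphic_map (subtopology M (fst c)) (top_of_set (snd c ` fst c)) (snd c)"
  using manifold c unfolding complex_manifold_def by (auto simp: case_prod_beta)

lemma triv:
  shows triv_open: "openin M (fst t)"
    and triv_bij: "y \<in> fst t \<Longrightarrow> bij_betw (snd t y) (E y) UNIV"
  using vbundle t unfolding holomorphic_vector_bundle_def by (auto simp: case_prod_beta)

lemma topspace_chart: "topspace (subtopology M (fst c)) = fst c"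
  using chart_open openin_subset by fastforce

lemma chart_inj: "inj_on (snd c) (fst c)"
  using homeomorphic_imp_injective_map[OF chart_homeo] topspace_chart by simp

lemma open_S: "open S"
proof -
  have "openin (top_of_set (snd c ` fst c)) S"
    unfolding S_def using homeomorphic_map_openness[OF chart_homeo, of "fst c \<inter> fst t"]
      topspace_chart chart_open triv_open
    by (metis inf.cobounded1 openin_Int openin_open_subtopology)
  then show ?thesis using chart(2) openin_open_trans by blast
qed

lemma point_S: "w \<in> S \<Longrightarrow> point w \<in> fst c" "w \<in> S \<Longrightarrow> point w \<in> fst t"
  "w \<in> S \<Longrightarrow> snd c (point w) = w"
  unfolding S_def point_def using chart_inj by (auto simp: inv_into_f_f)

lemma point_chart: "y \<in> fst c \<Longrightarrow> point (snd c y) = y"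
  unfolding point_def using chart_inj by (simp add: inv_into_f_f)

lemma chart_S: "y \<in> fst c \<Longrightarrow> y \<in> fst t \<Longrightarrow> snd c y \<in> S"
  unfolding S_def by blast

lemma chart_nbhd:
  assumes W: "open W" and y: "y \<in> fst c" "y \<in> fst t" "snd c y \<in> W"
  shows "\<exists>N. openin M N \<and> y \<in> N \<and> (\<forall>x\<in>N. x \<in> fst c \<and> x \<in> fst t \<and> snd c x \<in> W)"
proof -
  let ?X = "subtopology M (fst c)" and ?Y = "top_of_set (snd c ` fst c)"
  have "openin ?Y (snd c ` fst c \<inter> W)" using W by (simp add: openin_open_Int)
  from openin_continuous_map_preimage[OF homeomorphic_imp_continuous_map[OF chart_homeo] this]
  have "openin ?X {x \<in> fst c. snd c x \<in> snd c ` fst c \<inter> W}" by (simp only: topspace_chart)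
  then have "openin M {x \<in> fst c. snd c x \<in> snd c ` fst c \<inter> W}"
    using chart_open openin_trans_full by blast
  then have "openin M ({x \<in> fst c. snd c x \<in> snd c ` fst c \<inter> W} \<inter> fst t)"
    using triv_open by (rule openin_Int)
  then show ?thesis
    using y by (intro exI[of _ "{x \<in> fst c. snd c x \<in> snd c ` fst c \<inter> W} \<inter> fst t"] conjI) auto
qed

lemma smooth_twice_diff:
  assumes "smooth_fun \<A> W f" "fst c \<inter> fst t \<subseteq> W" "W \<subseteq> fst t"
  shows "twice_diff S (\<lambda>w. f (point w))"
proof -
  have "Cinf_on (local_rep c f) (snd c ` (fst c \<inter> W))"
    using assms(1) c unfolding smooth_fun_def by (auto simp: case_prod_beta)
  moreover have "fst c \<inter> W = fst c \<inter> fst t" using assms(2,3) by blast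
  ultimately show ?thesis
    using Cinf_on_twice_diff unfolding local_rep_def point_def S_def comp_def by metis
qed

lemma frame_in: "y \<in> fst t \<Longrightarrow> frame E t \<alpha> y \<in> E y"
  and triv_frame: "y \<in> fst t \<Longrightarrow> snd t y (frame E t \<alpha> y) = axis \<alpha> 1"
  using triv_bij[of y] unfolding frame_def bij_betw_def
  by (metis UNIV_I inv_into_into, metis UNIV_I f_inv_into_f)

lemma triv_vector:
  assumes "y \<in> fst t"
  obtains u where "u \<in> E y" "snd t y u = v"
  using triv_bij[OF assms] unfolding bij_betw_def by (metis UNIV_I imageE)

lemma is_zero_iff:
  assumes y: "y \<in> fst t" and u: "u \<in> E y"
  shows "is_zero \<T> y u \<longleftrightarrow> snd t y u = 0"
proof
  assume "is_zero \<T> y u"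
  then obtain s where s: "s \<in> \<T>" "y \<in> fst s" "snd s y u = 0" unfolding is_zero_def by auto
  have "\<forall>s\<in>\<T>. \<forall>t\<in>\<T>. \<exists>G :: 'm \<Rightarrow> complex^'r^'r.
      (\<forall>\<alpha> \<beta>. holo_fun \<A> (fst s \<inter> fst t) (\<lambda>x. G x $ \<alpha> $ \<beta>)) \<and>
      (\<forall>x\<in>fst s \<inter> fst t. \<forall>u\<in>E x. snd t x u = G x *v snd s x u)"
    using vbundle unfolding holomorphic_vector_bundle_def case_prod_beta by blast
  then obtain G :: "'m \<Rightarrow> complex^'r^'r"
    where "\<forall>x\<in>fst s \<inter> fst t. \<forall>u\<in>E x. snd t x u = G x *v snd s x u"
    using s(1) t by blast
  then have "snd t y u = G y *v snd s y u" using s(2) y u by blast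
  then show "snd t y u = 0" using s(3) by simp
next
  assume "snd t y u = 0"
  then show "is_zero \<T> y u" using t y unfolding is_zero_def by (auto simp: case_prod_beta)
qed

lemma metric_cip:
  assumes "y \<in> fst t" "u \<in> E y" "v \<in> E y"
  shows "h y u v = cip (P y *v snd t y u) (snd t y v)"
  using metric assms t unfolding hermitian_bundle_metric_def P_def form_of_matrix_cip[symmetric] by blast

lemma P_herm:
  assumes "y \<in> fst t"
  shows "adj (P y) = P y"
proof -
  have "h y v u = cnj (h y u v)" if "u \<in> E y" "v \<in> E y" for u v
    using metric assms that triv_open openin_subset unfolding hermitian_bundle_metric_def by blast
  from this[OF frame_in[OF assms] frame_in[OF assms], symmetric] show ?thesis
    by (simp add: P_def adj_def transpose_def form_matrix_def vec_eq_iff)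
qed

lemma P_posdef:
  assumes "y \<in> fst t"
  shows "posdef (P y)"
  unfolding posdef_def
proof (intro allI impI)
  fix v :: "complex^'r" assume "v \<noteq> 0"
  obtain u where u: "u \<in> E y" "snd t y u = v" using triv_vector[OF assms] .
  then have "\<not> is_zero \<T> y u" using is_zero_iff assms \<open>v \<noteq> 0\<close> by simp
  then have "0 < Re (h y u u)"
    using metric u assms triv_open openin_subset unfolding hermitian_bundle_metric_def tensor_pos_def by blast
  then show "0 < Re (cip (P y *v v) v)" using metric_cip assms u by simp
qed

lemma P_smooth: "twice_diff S (\<lambda>w. P (point w) $ \<alpha> $ \<beta>)"
proof -
  have "smooth_fun \<A> (fst t) (\<lambda>x. form_matrix E t h x $ \<beta> $ \<alpha>)"
    using metric t unfolding hermitian_bundle_metric_def by blast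
  from smooth_twice_diff[OF this] show ?thesis by (simp add: P_def transpose_def)
qed

lemma pd_point: "pd c a f y = wirt a (\<lambda>w. f (point w)) (snd c y)"
  by (simp add: pd_def local_rep_def point_def comp_def)

lemma chern_connection_Inr: "w \<in> S \<Longrightarrow> chern_connection E h c t (Inr j) (point w) = 0"
  and chern_connection_Inl:
    "w \<in> S \<Longrightarrow> P (point w) ** chern_connection E h c t (Inl i) (point w) = mwirt (Inl i) (\<lambda>w. P (point w)) w"
proof -
  assume w: "w \<in> S"
  let ?A = "\<lambda>a. chern_connection E h c t a (point w)"
  have ex1: "\<exists>!A. is_chern_at c (form_matrix E t h) (point w) A"
    by (rule chern_ex1[OF manifold vbundle metric c point_S(1)[OF w] t point_S(2)[OF w]])
  have ch: "is_chern_at c (form_matrix E t h) (point w) ?A"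
    using theI'[OF ex1] unfolding chern_connection_def .
  then show zero: "?A (Inr j) = 0" for j unfolding is_chern_at_def by blast
  have "pd c (Inl i) (\<lambda>y. form_matrix E t h y $ \<alpha> $ \<beta>) (point w)
      = (\<Sum>\<gamma>\<in>UNIV. ?A (Inl i) $ \<gamma> $ \<alpha> * form_matrix E t h (point w) $ \<gamma> $ \<beta>)" for \<alpha> \<beta>
    using ch zero[of i] unfolding is_chern_at_def by simp
  then show "P (point w) ** ?A (Inl i) = mwirt (Inl i) (\<lambda>w. P (point w)) w"
    using point_S(3)[OF w]
    by (simp add: pd_point P_def transpose_def mwirt_def matrix_matrix_mult_def vec_eq_iff mult.commute)
qed

text \<open>
  The adjoint of an endomorphism with matrix \<open>A\<close> has the matrix \<open>P\<^sup>-\<^sup>1 A\<^sup>* P\<close>. The proof includes that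
  the definite description in the definition of the adjoint is satisfied by exactly one vector.
\<close>

lemma fibre_adjoint_matrix:
  assumes y: "y \<in> fst t"
    and lin: "\<And>u. u \<in> E y \<Longrightarrow> f u \<in> E y \<and> snd t y (f u) = A *v snd t y u"
  shows "P y ** end_matrix E t y (fibre_adjoint E h y f) = adj A ** P y"
proof -
  obtain K where K: "P y ** K = mat 1" "K ** P y = mat 1" using posdef_inverse[OF P_posdef[OF y]] .
  let ?B = "K ** (adj A ** P y)"
  have adjoint: "fibre_adjoint E h y f w \<in> E y \<and> snd t y (fibre_adjoint E h y f w) = ?B *v snd t y w"
    if w: "w \<in> E y" for w
  proof -
    have iff: "(\<forall>v\<in>E y. h y (f v) w = h y v w') \<longleftrightarrow> snd t y w' = ?B *v snd t y w" if w': "w' \<in> E y" for w'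
    proof -
      have "(\<forall>v\<in>E y. h y (f v) w = h y v w') \<longleftrightarrow>
          (\<forall>v\<in>E y. cip (snd t y v) (adj A *v (P y *v snd t y w)) = cip (snd t y v) (P y *v snd t y w'))"
        using lin w w' y by (simp add: metric_cip cip_adj P_herm)
      also have "\<dots> \<longleftrightarrow> (\<forall>v. cip v (adj A *v (P y *v snd t y w)) = cip v (P y *v snd t y w'))"
        by (metis triv_vector[OF y])
      also have "\<dots> \<longleftrightarrow> adj A *v (P y *v snd t y w) = P y *v snd t y w'"
        by (rule iffI, rule cip_ext) simp_all
      also have "\<dots> \<longleftrightarrow> snd t y w' = ?B *v snd t y w"
      proof
        assume "adj A *v (P y *v snd t y w) = P y *v snd t y w'"
        then have "K *v (adj A *v (P y *v snd t y w)) = K *v (P y *v snd t y w')" by simp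
        then show "snd t y w' = ?B *v snd t y w" by (simp add: matrix_vector_mul_assoc K matrix_mul_assoc)
      next
        assume "snd t y w' = ?B *v snd t y w"
        then have "P y *v snd t y w' = (P y ** K) *v (adj A *v (P y *v snd t y w))"
          by (simp add: matrix_vector_mul_assoc matrix_mul_assoc)
        then show "adj A *v (P y *v snd t y w) = P y *v snd t y w'" by (simp add: K)
      qed
      finally show ?thesis .
    qed
    obtain w1 where w1: "w1 \<in> E y" "snd t y w1 = ?B *v snd t y w" using triv_vector[OF y] .
    have uniq: "w2 = w1" if "w2 \<in> E y" "snd t y w2 = ?B *v snd t y w" for w2
      using triv_bij[OF y] w1 that unfolding bij_betw_def inj_on_def by metis
    have "fibre_adjoint E h y f w = w1"
      unfolding fibre_adjoint_def by (rule the_equality) (use iff w1 uniq in blast)+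
    then show ?thesis using w1 by simp
  qed
  have "end_matrix E t y (fibre_adjoint E h y f) $ \<gamma> $ \<alpha> = ?B $ \<gamma> $ \<alpha>" for \<gamma> \<alpha>
  proof -
    have "snd t y (fibre_adjoint E h y f (frame E t \<alpha> y)) = ?B *v axis \<alpha> 1"
      using adjoint[OF frame_in[OF y]] triv_frame[OF y] by simp
    then show ?thesis by (simp add: end_matrix_def matrix_vector_mult_axis)
  qed
  then have "end_matrix E t y (fibre_adjoint E h y f) = ?B" by (simp add: vec_eq_iff)
  then show ?thesis by (simp add: matrix_mul_assoc K)
qed

end

text \<open>
  A Higgs field in addition, and a point \<open>x\<close> in the domain of the chart and of the trivialisation.
  In coordinates, \<open>\<Gamma>\<close> is the (1,0)-part of the Chern connection,
  \<open>T\<close> the Higgs field and \<open>Ts\<close> its adjoint.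
\<close>

locale higgs_in_frame = metric_in_frame M \<A> E \<T> h c t
  for M :: "'m topology" and \<A> :: "('m, 'n::finite) chart set" and E :: "'m \<Rightarrow> 'e set"
    and \<T> :: "('m, 'e, 'r::finite) triv set" and h :: "('m, 'e) form"
    and c :: "('m, 'n) chart" and t :: "('m, 'e, 'r) triv" +
  fixes \<theta> :: "('m, 'n) chart \<Rightarrow> 'n \<Rightarrow> 'm \<Rightarrow> 'e \<Rightarrow> 'e" and x :: 'm
  assumes higgs: "higgs_field \<A> E \<T> \<theta>" and x: "x \<in> fst c" "x \<in> fst t"
begin

definition \<Gamma> :: "'n \<Rightarrow> complex^'n \<Rightarrow> complex^'r^'r" where
  "\<Gamma> i w = chern_connection E h c t (Inl i) (point w)"

definition T :: "'n \<Rightarrow> complex^'n \<Rightarrow> complex^'r^'r" where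
  "T i w = end_matrix E t (point w) (\<theta> c i (point w))"

definition Ts :: "'n \<Rightarrow> complex^'n \<Rightarrow> complex^'r^'r" where
  "Ts j w = end_matrix E t (point w) (fibre_adjoint E h (point w) (\<theta> c j (point w)))"

lemma higgs_linear:
  "y \<in> fst c \<Longrightarrow> y \<in> fst t \<Longrightarrow> u \<in> E y \<Longrightarrow>
    \<theta> c i y u \<in> E y \<and> snd t y (\<theta> c i y u) = end_matrix E t y (\<theta> c i y) *v snd t y u"
  and higgs_smooth: "smooth_fun \<A> (fst c \<inter> fst t) (\<lambda>y. end_matrix E t y (\<theta> c i y) $ \<gamma> $ \<alpha>)"
  and higgs_holo: "y \<in> fst c \<Longrightarrow> y \<in> fst t \<Longrightarrow>
    pd c (Inr j) (\<lambda>y. end_matrix E t y (\<theta> c i y) $ \<gamma> $ \<alpha>) y = 0"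
  using higgs c t unfolding higgs_field_def by blast+

sublocale l: local_higgs_metric S "snd c x" "\<lambda>w. P (point w)" \<Gamma> T Ts
proof
  show "open S" "snd c x \<in> S" using open_S chart_S x by auto
  show "twice_diff S (\<lambda>w. P (point w) $ \<alpha> $ \<beta>)" for \<alpha> \<beta> by (rule P_smooth)
  show "adj (P (point w)) = P (point w)" "posdef (P (point w))" if "w \<in> S" for w
    using P_herm P_posdef point_S that by blast+
  show "mdiff (T i) (snd c x)" for i
    unfolding mdiff_def T_def
    using twice_diffD(1)[OF smooth_twice_diff[OF higgs_smooth] \<open>snd c x \<in> S\<close>] by blast
  show "mwirt (Inr j) (T i) (snd c x) = 0" for i j
    unfolding mwirt_def T_def using higgs_holo[OF x] by (simp add: pd_point vec_eq_iff)
  show "P (point w) ** \<Gamma> i w = mwirt (Inl i) (\<lambda>w. P (point w)) w" if "w \<in> S" for i w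
    unfolding \<Gamma>_def by (rule chern_connection_Inl[OF that])
  show "P (point w) ** Ts j w = adj (T j w) ** P (point w)" if "w \<in> S" for j w
    unfolding Ts_def T_def
    by (rule fibre_adjoint_matrix[OF point_S(2)[OF that] higgs_linear[OF point_S(1,2)[OF that]]])
qed

lemma curvature_F: "curvature c (higgs_connection E \<theta> h c t) (Inl i) (Inr j) x = l.F i j"
proof -
  let ?A = "higgs_connection E \<theta> h c t"
  have A_Inl: "?A (Inl i) (point w) = \<Gamma> i w + T i w" for w
    by (simp add: higgs_connection_def higgs_form_def higgs_adjoint_form_def \<Gamma>_def T_def)
  have A_Inr: "?A (Inr j) (point w) = Ts j w" if "w \<in> S" for w
    using chern_connection_Inr[OF that]
    by (simp add: higgs_connection_def higgs_form_def higgs_adjoint_form_def Ts_def)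
  have 0: "pd c b (\<lambda>y. k) y = 0" for b k and y :: 'm by (simp add: pd_point)
  have "cov_deriv c ?A b (\<lambda>_. axis \<alpha> 1) y $ \<gamma> = ?A b y $ \<gamma> $ \<alpha>" for b \<alpha> y \<gamma>
    by (simp add: cov_deriv_def 0 matrix_vector_mult_axis)
  then have "curvature c ?A a b x = mwirt a (\<lambda>w. ?A b (point w)) (snd c x) + ?A a x ** ?A b x
      - (mwirt b (\<lambda>w. ?A a (point w)) (snd c x) + ?A b x ** ?A a x)" for a b
    by (simp add: curvature_def ext_cov_deriv_def vec_eq_iff cov_deriv_def[of c ?A _ "cov_deriv _ _ _ _"]
        pd_point mwirt_def matrix_matrix_mult_def matrix_vector_mult_def)
  moreover have "mwirt (Inl i) (\<lambda>w. ?A (Inr j) (point w)) (snd c x) = mwirt (Inl i) (Ts j) (snd c x)"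
    by (rule mwirt_cong[OF l.S A_Inr])
  moreover have "?A (Inl i) x = \<Gamma> i (snd c x) + T i (snd c x)" "?A (Inr j) x = Ts j (snd c x)"
    using A_Inl[of "snd c x"] A_Inr[OF l.S(2)] point_chart[OF x(1)] by simp_all
  ultimately show ?thesis by (simp add: l.F_def A_Inl)
qed

text \<open>The Hermitian-Yang-Mills tensor as the trace of the lowered curvature.\<close>

lemma hym_matrix_trace:
  "form_of_matrix (hym_matrix E g \<theta> h c t x) v v =
    (\<Sum>i\<in>UNIV. \<Sum>j\<in>UNIV. matrix_inv (g c x) $ j $ i * cip ((P x ** l.F i j) *v v) v)"
proof -
  have "higgs_curvature E \<theta> h c t (Inl i) (Inr j) x = transpose (P x ** l.F i j)" for i j
    unfolding higgs_curvature_def curvature_F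
    by (simp add: P_def transpose_def matrix_matrix_mult_def)
  then have "form_of_matrix (higgs_curvature E \<theta> h c t (Inl i) (Inr j) x) v v = cip ((P x ** l.F i j) *v v) v" for i j
    by (simp add: form_of_matrix_cip)
  moreover have "hym_matrix E g \<theta> h c t x = (\<chi> \<alpha> \<beta>. \<Sum>i\<in>UNIV. \<Sum>j\<in>UNIV.
      matrix_inv (g c x) $ j $ i * higgs_curvature E \<theta> h c t (Inl i) (Inr j) x $ \<alpha> $ \<beta>)"
    by (simp add: hym_matrix_def Lambda_def)
  ultimately show ?thesis by (simp add: form_of_matrix_combination)
qed

end


section \<open>Strict domination of one metric by a multiple of another\<close>

text \<open>The strict inequality \<open>h < l h\<^sub>0\<close> of Hermitian forms on the fibre over \<open>x\<close>.\<close>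

definition strictly_below ::
  "('m \<Rightarrow> 'e set) \<Rightarrow> ('m, 'e, 'r::finite) triv set \<Rightarrow> ('m, 'e) form \<Rightarrow> ('m, 'e) form \<Rightarrow> real \<Rightarrow> 'm \<Rightarrow> bool" where
  "strictly_below E \<T> h h\<^sub>0 l x \<longleftrightarrow>
     (\<forall>u\<in>E x. \<not> is_zero \<T> x u \<longrightarrow> Re (h x u u) < l * Re (h\<^sub>0 x u u))"

locale two_metrics_in_frame = metric_in_frame M \<A> E \<T> h c t
  for M :: "'m topology" and \<A> :: "('m, 'n::finite) chart set" and E :: "'m \<Rightarrow> 'e set"
    and \<T> :: "('m, 'e, 'r::finite) triv set" and h :: "('m, 'e) form"
    and c :: "('m, 'n) chart" and t :: "('m, 'e, 'r) triv" +
  fixes h\<^sub>0 :: "('m, 'e) form"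
  assumes metric0: "hermitian_bundle_metric M \<A> E \<T> h\<^sub>0"
begin

sublocale m0: metric_in_frame M \<A> E \<T> h\<^sub>0 c t
  by unfold_locales (rule manifold vbundle metric0 c t)+

lemma strictly_below_iff:
  assumes y: "y \<in> fst t"
  shows "strictly_below E \<T> h h\<^sub>0 l y \<longleftrightarrow> posdef (l *\<^sub>R m0.P y - P y)"
proof
  assume below: "strictly_below E \<T> h h\<^sub>0 l y"
  show "posdef (l *\<^sub>R m0.P y - P y)"
    unfolding posdef_def cip_scaled_diff
  proof (intro allI impI)
    fix v :: "complex^'r" assume "v \<noteq> 0"
    obtain u where u: "u \<in> E y" "snd t y u = v" using triv_vector[OF y] .
    then have "Re (h y u u) < l * Re (h\<^sub>0 y u u)"
      using below is_zero_iff[OF y u(1)] \<open>v \<noteq> 0\<close> unfolding strictly_below_def by blast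
    then show "0 < Re (l *\<^sub>R cip (m0.P y *v v) v - cip (P y *v v) v)"
      using u y by (simp add: metric_cip m0.metric_cip)
  qed
next
  assume pos: "posdef (l *\<^sub>R m0.P y - P y)"
  show "strictly_below E \<T> h h\<^sub>0 l y"
    unfolding strictly_below_def
  proof (intro ballI impI)
    fix u assume u: "u \<in> E y" "\<not> is_zero \<T> y u"
    then have "snd t y u \<noteq> 0" using is_zero_iff[OF y] by blast
    from posdefD[OF pos this] show "Re (h y u u) < l * Re (h\<^sub>0 y u u)"
      using u y by (simp add: metric_cip m0.metric_cip cip_scaled_diff)
  qed
qed

lemma strictly_below_nbhd:
  assumes y: "y \<in> fst c" "y \<in> fst t" and below: "strictly_below E \<T> h h\<^sub>0 l y"
  shows "\<exists>N. openin M N \<and> y \<in> N \<and> (\<forall>x\<in>N. strictly_below E \<T> h h\<^sub>0 l x)"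
proof -
  let ?Q = "\<lambda>w. l *\<^sub>R m0.P (point w) - P (point w)"
  have lim: "((\<lambda>w. P (point w) $ \<alpha> $ \<beta>) \<longlongrightarrow> P y $ \<alpha> $ \<beta>) (nhds (snd c y))"
    "((\<lambda>w. m0.P (point w) $ \<alpha> $ \<beta>) \<longlongrightarrow> m0.P y $ \<alpha> $ \<beta>) (nhds (snd c y))" for \<alpha> \<beta>
  proof -
    have nhds: "(f \<longlongrightarrow> f a) (nhds a)" if "f differentiable (at a)" for f :: "complex^'n \<Rightarrow> complex" and a
      using differentiable_imp_continuous_within[OF that] unfolding isCont_def tendsto_at_iff_tendsto_nhds .
    show "((\<lambda>w. P (point w) $ \<alpha> $ \<beta>) \<longlongrightarrow> P y $ \<alpha> $ \<beta>) (nhds (snd c y))"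
      "((\<lambda>w. m0.P (point w) $ \<alpha> $ \<beta>) \<longlongrightarrow> m0.P y $ \<alpha> $ \<beta>) (nhds (snd c y))"
      using nhds[OF twice_diffD(1)[OF P_smooth chart_S[OF y]]] nhds[OF twice_diffD(1)[OF m0.P_smooth chart_S[OF y]]]
      unfolding point_chart[OF y(1)] .
  qed
  have "\<forall>\<^sub>F w in nhds (snd c y). posdef (?Q w)"
  proof (rule posdef_eventually)
    show "posdef (l *\<^sub>R m0.P y - P y)" using below strictly_below_iff[OF y(2)] by simp
    show "((\<lambda>w. ?Q w $ \<alpha> $ \<beta>) \<longlongrightarrow> (l *\<^sub>R m0.P y - P y) $ \<alpha> $ \<beta>) (nhds (snd c y))" for \<alpha> \<beta>
      unfolding vector_minus_component vector_scaleR_component by (intro tendsto_intros lim)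
  qed
  then obtain W where W: "open W" "snd c y \<in> W" "\<And>w. w \<in> W \<Longrightarrow> posdef (?Q w)"
    unfolding eventually_nhds by blast
  from chart_nbhd[OF W(1) y W(2)] obtain N where N: "openin M N" "y \<in> N"
    "\<And>x. x \<in> N \<Longrightarrow> x \<in> fst c \<and> x \<in> fst t \<and> snd c x \<in> W" by blast
  have "strictly_below E \<T> h h\<^sub>0 l x" if "x \<in> N" for x
    using W(3)[of "snd c x"] N(3)[OF that] by (simp add: point_chart strictly_below_iff)
  then show ?thesis using N by blast
qed

lemma strictly_below_smaller:
  assumes y: "y \<in> fst t" and below: "strictly_below E \<T> h h\<^sub>0 l y"
  shows "\<exists>k<l. strictly_below E \<T> h h\<^sub>0 k y"
proof -
  have "\<forall>\<^sub>F k in at_left l. posdef (k *\<^sub>R m0.P y - P y)"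
  proof (rule posdef_eventually)
    show "posdef (l *\<^sub>R m0.P y - P y)" using below strictly_below_iff[OF y] by simp
    show "((\<lambda>k. (k *\<^sub>R m0.P y - P y) $ \<alpha> $ \<beta>) \<longlongrightarrow> (l *\<^sub>R m0.P y - P y) $ \<alpha> $ \<beta>) (at_left l)" for \<alpha> \<beta>
      unfolding vector_minus_component vector_scaleR_component by (intro tendsto_intros)
  qed
  moreover have "\<forall>\<^sub>F k in at_left l. k < l" by (simp add: eventually_at_filter)
  ultimately have "\<forall>\<^sub>F k in at_left l. k < l \<and> posdef (k *\<^sub>R m0.P y - P y)"
    by eventually_elim simp
  then obtain k where "k < l" "posdef (k *\<^sub>R m0.P y - P y)"
    using eventually_happens' trivial_limit_at_left_real by blast
  then show ?thesis using strictly_below_iff[OF y] by blast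
qed

lemma strictly_below_ex:
  assumes y: "y \<in> fst t"
  shows "\<exists>l. strictly_below E \<T> h h\<^sub>0 l y"
proof -
  \<comment> \<open>a small multiple of \<open>h\<close> is below \<open>h\<^sub>0\<close>\<close>
  have "\<forall>\<^sub>F s in at_right (0::real). posdef (m0.P y - s *\<^sub>R P y)"
  proof (rule posdef_eventually)
    show "posdef (m0.P y)" by (rule m0.P_posdef[OF y])
    have "((\<lambda>s. m0.P y $ \<alpha> $ \<beta> - s *\<^sub>R P y $ \<alpha> $ \<beta>) \<longlongrightarrow> m0.P y $ \<alpha> $ \<beta> - 0 *\<^sub>R P y $ \<alpha> $ \<beta>) (at_right 0)" for \<alpha> \<beta>
      by (intro tendsto_intros)
    then show "((\<lambda>s. (m0.P y - s *\<^sub>R P y) $ \<alpha> $ \<beta>) \<longlongrightarrow> m0.P y $ \<alpha> $ \<beta>) (at_right 0)" for \<alpha> \<beta>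
      by simp
  qed
  moreover have "\<forall>\<^sub>F s in at_right (0::real). 0 < s" by (simp add: eventually_at_filter)
  ultimately have "\<forall>\<^sub>F s in at_right (0::real). 0 < s \<and> posdef (m0.P y - s *\<^sub>R P y)"
    by eventually_elim simp
  then obtain s where s: "0 < s" "posdef (m0.P y - s *\<^sub>R P y)"
    using eventually_happens' trivial_limit_at_right_real by blast
  have "0 < Re (cip (((1 / s) *\<^sub>R m0.P y - P y) *v v) v)" if "v \<noteq> 0" for v
  proof -
    have "m0.P y - s *\<^sub>R P y = s *\<^sub>R ((1 / s) *\<^sub>R m0.P y - P y) - 0"
      using s(1) by (simp add: scaleR_diff_right)
    then have "cip ((m0.P y - s *\<^sub>R P y) *v v) v = s *\<^sub>R cip (((1 / s) *\<^sub>R m0.P y - P y) *v v) v"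
      by (simp only: cip_scaled_diff) (simp add: cip_def matrix_vector_mult_def)
    with posdefD[OF s(2) that] show ?thesis using s(1) by (simp add: zero_less_mult_iff)
  qed
  then show ?thesis using strictly_below_iff[OF y] unfolding posdef_def by blast
qed

end

text \<open>A monotone family of open sets that covers a compact space has a member containing it.\<close>

lemma compact_directed_cover:
  fixes U :: "real \<Rightarrow> 'a set"
  assumes compact: "compact_space X" and op: "\<And>l. openin X (U l)"
    and mono: "\<And>k l. k \<le> l \<Longrightarrow> U k \<subseteq> U l"
    and cover: "topspace X \<subseteq> (\<Union>l\<in>I. U l)" and ne: "I \<noteq> {}"
  obtains l where "l \<in> I" "topspace X \<subseteq> U l"
proof -
  obtain \<F> where \<F>: "finite \<F>" "\<F> \<subseteq> U ` I" "topspace X \<subseteq> \<Union>\<F>"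
    using compact cover op unfolding compact_space_alt by (metis (no_types, lifting) imageE)
  then obtain J where J: "finite J" "J \<subseteq> I" "\<F> = U ` J"
    by (meson finite_subset_image)
  obtain i where i: "i \<in> I" using ne by blast
  have fin: "finite (insert i J)" using J(1) by simp
  let ?l = "Max (insert i J)"
  have "?l \<in> insert i J" using fin by (intro Max_in) auto
  moreover have "insert i J \<subseteq> I" using i J(2) by blast
  ultimately have "?l \<in> I" by (rule rev_subsetD)
  moreover have "U j \<subseteq> U ?l" if "j \<in> J" for j using that fin by (intro mono Max_ge) auto
  then have "topspace X \<subseteq> U ?l" using \<F>(3) unfolding J(3) by blast
  ultimately show ?thesis by (rule that)
qed


section \<open>The maximum principle\<close>

theorem theorem1p3:
  fixes M :: "'m topology"
    and \<A> :: "('m, 'n::finite) chart set"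
    and E :: "'m \<Rightarrow> 'e set"
    and \<T> :: "('m, 'e, 'r::finite) triv set"
    and g :: "('m, 'n) chart \<Rightarrow> 'm \<Rightarrow> complex^'n^'n"
    and \<theta> :: "('m, 'n) chart \<Rightarrow> 'n \<Rightarrow> 'm \<Rightarrow> 'e \<Rightarrow> 'e"
    and h h\<^sub>0 :: "('m, 'e) form"
  assumes "complex_manifold M \<A>"
    and "compact_space M"
    and "hermitian_metric \<A> g"
    and "holomorphic_vector_bundle M \<A> E \<T>"
    and "higgs_field \<A> E \<T> \<theta>"
    and "hermitian_bundle_metric M \<A> E \<T> h"
    and "hermitian_bundle_metric M \<A> E \<T> h\<^sub>0"
    and "tensor_pos M E \<T> (hym_tensor \<A> E \<T> g \<theta> h\<^sub>0)"
    and "tensor_le M E (hym_tensor \<A> E \<T> g \<theta> h) (hym_tensor \<A> E \<T> g \<theta> h\<^sub>0)"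
  shows "tensor_le M E h h\<^sub>0"
proof (rule ccontr)
  assume "\<not> tensor_le M E h h\<^sub>0"
  then obtain x1 u1 where x1: "x1 \<in> topspace M" "u1 \<in> E x1"
    and gt: "Re (h\<^sub>0 x1 u1 u1) < Re (h x1 u1 u1)"
    unfolding tensor_le_def by (auto simp: not_le)
  let ?below = "strictly_below E \<T> h h\<^sub>0"
  have cover: "\<exists>c. c \<in> \<A> \<and> x \<in> fst c" "\<exists>t. t \<in> \<T> \<and> x \<in> fst t" if "x \<in> topspace M" for x
  proof -
    have "(\<Union>c\<in>\<A>. fst c) = topspace M" using assms(1) unfolding complex_manifold_def by (elim conjE)
    then show "\<exists>c. c \<in> \<A> \<and> x \<in> fst c" using that by blast
    have "(\<Union>t\<in>\<T>. fst t) = topspace M" using assms(4) unfolding holomorphic_vector_bundle_def by (elim conjE)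
    then show "\<exists>t. t \<in> \<T> \<and> x \<in> fst t" using that by blast
  qed
  have frame: "\<exists>c t. two_metrics_in_frame M \<A> E \<T> h c t h\<^sub>0 \<and> x \<in> fst c \<and> x \<in> fst t"
    if x: "x \<in> topspace M" for x
  proof -
    obtain c t where "c \<in> \<A>" "x \<in> fst c" "t \<in> \<T>" "x \<in> fst t" using cover[OF x] by blast
    then show ?thesis
      using assms(1,4,6,7) by (intro exI conjI) (unfold_locales, auto)
  qed
  have "tensor_pos M E \<T> h\<^sub>0" using assms(7) unfolding hermitian_bundle_metric_def by (elim conjE)
  then have pos: "0 < Re (h\<^sub>0 x u u)" if "x \<in> topspace M" "u \<in> E x" "\<not> is_zero \<T> x u" for x u
    using that unfolding tensor_pos_def by blast
  have zero: "h x u u = 0 \<and> h\<^sub>0 x u u = 0"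
    if "x \<in> topspace M" "u \<in> E x" "is_zero \<T> x u" for x u
  proof -
    obtain c t where "two_metrics_in_frame M \<A> E \<T> h c t h\<^sub>0" and xt: "x \<in> fst t"
      using frame[OF \<open>x \<in> topspace M\<close>] by blast
    then interpret two_metrics_in_frame M \<A> E \<T> h c t h\<^sub>0 by simp
    have "snd t x u = 0" using is_zero_iff[OF xt] that by simp
    then show ?thesis using metric_cip m0.metric_cip xt that by simp
  qed
  have x1_nz: "\<not> is_zero \<T> x1 u1" using zero[OF x1] gt by auto
  \<comment> \<open>the set of factors by which \<open>h\<^sub>0\<close> strictly dominates \<open>h\<close>, and its infimum\<close>
  define L where "L = {l. \<forall>x\<in>topspace M. ?below l x}"
  define U where "U l = {x \<in> topspace M. ?below l x}" for l
  have L_iff: "l \<in> L \<longleftrightarrow> topspace M \<subseteq> U l" for l unfolding L_def U_def by blast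
  have U_open: "openin M (U l)" for l
  proof (subst openin_subopen, intro ballI)
    fix x assume "x \<in> U l"
    then have x: "x \<in> topspace M" "?below l x" unfolding U_def by auto
    obtain c t where ct: "two_metrics_in_frame M \<A> E \<T> h c t h\<^sub>0" "x \<in> fst c" "x \<in> fst t"
      using frame[OF x(1)] by blast
    obtain N where N: "openin M N" "x \<in> N" "\<forall>y\<in>N. ?below l y"
      using two_metrics_in_frame.strictly_below_nbhd[OF ct x(2)] by blast
    then have "N \<subseteq> U l" unfolding U_def using openin_subset[OF N(1)] by blast
    then show "\<exists>N. openin M N \<and> x \<in> N \<and> N \<subseteq> U l" using N by blast
  qed
  have U_mono: "U k \<subseteq> U l" if "k \<le> l" for k l
  proof
    fix x assume "x \<in> U k"
    then have x: "x \<in> topspace M" "?below k x" unfolding U_def by auto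
    have "?below l x" unfolding strictly_below_def
    proof (intro ballI impI)
      fix u assume u: "u \<in> E x" "\<not> is_zero \<T> x u"
      have "Re (h x u u) < k * Re (h\<^sub>0 x u u)" using x(2) u unfolding strictly_below_def by blast
      also have "\<dots> \<le> l * Re (h\<^sub>0 x u u)" using that pos[OF x(1) u] by (simp add: mult_right_mono)
      finally show "Re (h x u u) < l * Re (h\<^sub>0 x u u)" .
    qed
    then show "x \<in> U l" using x(1) unfolding U_def by simp
  qed
  have L_ne: "L \<noteq> {}"
  proof -
    have "topspace M \<subseteq> (\<Union>l\<in>UNIV. U l)"
    proof
      fix x assume x: "x \<in> topspace M"
      obtain c t where ct: "two_metrics_in_frame M \<A> E \<T> h c t h\<^sub>0" "x \<in> fst t"
        using frame[OF x] by blast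
      obtain l where "?below l x" using two_metrics_in_frame.strictly_below_ex[OF ct] by blast
      then show "x \<in> (\<Union>l\<in>UNIV. U l)" using x unfolding U_def by blast
    qed
    from compact_directed_cover[OF assms(2) U_open U_mono this UNIV_not_empty]
    obtain l where "topspace M \<subseteq> U l" by blast
    then show ?thesis using L_iff by blast
  qed
  have L_bdd: "bdd_below L"
  proof (rule bdd_belowI)
    fix l assume "l \<in> L"
    then have "?below l x1" using x1(1) unfolding L_def by blast
    then have "Re (h x1 u1 u1) < l * Re (h\<^sub>0 x1 u1 u1)"
      unfolding strictly_below_def using x1(2) x1_nz by blast
    then have "1 * Re (h\<^sub>0 x1 u1 u1) < l * Re (h\<^sub>0 x1 u1 u1)" using gt by simp
    then show "1 \<le> l" using pos[OF x1 x1_nz] by (simp add: less_imp_le)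
  qed
  define l where "l = Inf L"
  have above: "k \<in> L" if "l < k" for k
  proof -
    from cInf_lessD[OF L_ne that[unfolded l_def]] obtain j where "j \<in> L" "j < k" by blast
    then show ?thesis unfolding L_iff using U_mono[of j k] by (meson less_imp_le subset_trans)
  qed
  have dom: "Re (h x u u) \<le> l * Re (h\<^sub>0 x u u)" if "x \<in> topspace M" "u \<in> E x" for x u
  proof (cases "is_zero \<T> x u")
    case False
    have "Re (h x u u) / Re (h\<^sub>0 x u u) \<le> k" if "l < k" for k
    proof -
      have "?below k x" using above[OF that] \<open>x \<in> topspace M\<close> unfolding L_def by blast
      then have "Re (h x u u) < k * Re (h\<^sub>0 x u u)"
        using \<open>u \<in> E x\<close> False unfolding strictly_below_def by blast
      then show ?thesis
        using pos[OF \<open>x \<in> topspace M\<close> \<open>u \<in> E x\<close> False] by (simp add: pos_divide_le_eq)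
    qed
    then have "Re (h x u u) / Re (h\<^sub>0 x u u) \<le> l" by (rule dense_ge)
    then show ?thesis using pos[OF that False] by (simp add: pos_divide_le_eq)
  qed (simp add: zero that)
  have "1 * Re (h\<^sub>0 x1 u1 u1) < l * Re (h\<^sub>0 x1 u1 u1)" using dom[OF x1] gt by simp
  \<comment> \<open>\<open>l \<ge> 1\<close> alone would not suffice; the failure at \<open>x1\<close> makes it strict\<close>
  then have l1: "1 < l" using pos[OF x1 x1_nz] by simp
  have "l \<notin> L"
  proof
    assume "l \<in> L"
    have "topspace M \<subseteq> (\<Union>k\<in>{..<l}. U k)"
    proof
      fix x assume x: "x \<in> topspace M"
      obtain c t where ct: "two_metrics_in_frame M \<A> E \<T> h c t h\<^sub>0" "x \<in> fst t"
        using frame[OF x] by blast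
      have "?below l x" using \<open>l \<in> L\<close> x unfolding L_def by blast
      from two_metrics_in_frame.strictly_below_smaller[OF ct this]
      obtain k where "k < l" "?below k x" by blast
      then show "x \<in> (\<Union>k\<in>{..<l}. U k)" using x unfolding U_def by blast
    qed
    from compact_directed_cover[OF assms(2) U_open U_mono this lessThan_non_empty]
    obtain k where "k < l" "k \<in> L" unfolding L_iff by blast
    then show False using cInf_lower[OF \<open>k \<in> L\<close> L_bdd] unfolding l_def by linarith
  qed
  then obtain x where x: "x \<in> topspace M" and "\<not> ?below l x" unfolding L_def by blast
  then obtain u where u: "u \<in> E x" "\<not> is_zero \<T> x u" and "l * Re (h\<^sub>0 x u u) \<le> Re (h x u u)"
    unfolding strictly_below_def not_less by (meson not_less)
  then have null: "Re (h x u u) = l * Re (h\<^sub>0 x u u)" using dom[OF x u(1)] by linarith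
  \<comment> \<open>the chart and the trivialisation in which the Hermitian-Yang-Mills tensor is computed at \<open>x\<close>\<close>
  define c where "c = (SOME c. c \<in> \<A> \<and> x \<in> fst c)"
  define t where "t = (SOME t. t \<in> \<T> \<and> x \<in> fst t)"
  have cA: "c \<in> \<A> \<and> x \<in> fst c" and tT: "t \<in> \<T> \<and> x \<in> fst t"
    unfolding c_def t_def using someI_ex[OF cover(1)[OF x]] someI_ex[OF cover(2)[OF x]] by blast+
  interpret two_metrics_in_frame M \<A> E \<T> h c t h\<^sub>0
    using assms(1,4,6,7) cA tT by unfold_locales auto
  interpret k: higgs_in_frame M \<A> E \<T> h c t \<theta> x
    by unfold_locales (rule assms(5) conjunct2[OF cA] conjunct2[OF tT])+
  interpret k0: higgs_in_frame M \<A> E \<T> h\<^sub>0 c t \<theta> x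
    by unfold_locales (rule assms(5) conjunct2[OF cA] conjunct2[OF tT])+
  let ?v = "snd t x u"
  let ?B = "\<lambda>i j. cip ((P x ** k.l.F i j) *v ?v) ?v - l * cip ((m0.P x ** k0.l.F i j) *v ?v) ?v"
  have px: "point (snd c x) = x" using point_chart cA by blast
  have hym: "hym_tensor \<A> E \<T> g \<theta> h x u u
      = (\<Sum>i\<in>UNIV. \<Sum>j\<in>UNIV. matrix_inv (g c x) $ j $ i * cip ((P x ** k.l.F i j) *v ?v) ?v)"
    using k.hym_matrix_trace[of g ?v] by (simp only: hym_tensor_def Let_def c_def t_def)
  have hym0: "hym_tensor \<A> E \<T> g \<theta> h\<^sub>0 x u u
      = (\<Sum>i\<in>UNIV. \<Sum>j\<in>UNIV. matrix_inv (g c x) $ j $ i * cip ((m0.P x ** k0.l.F i j) *v ?v) ?v)"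
    using k0.hym_matrix_trace[of g ?v] by (simp only: hym_tensor_def Let_def c_def t_def)
  have dom_S: "Re (cip (P (point w) *v v) v) \<le> l * Re (cip (m0.P (point w) *v v) v)" if w: "w \<in> S" for w v
  proof -
    obtain u' where u': "u' \<in> E (point w)" "snd t (point w) u' = v" using triv_vector[OF point_S(2)[OF w]] .
    have "point w \<in> topspace M" using point_S(2)[OF w] triv_open openin_subset by blast
    from dom[OF this u'(1)] show ?thesis
      using u' point_S(2)[OF w] by (simp add: metric_cip m0.metric_cip)
  qed
  have null_S: "Re (cip (P (point (snd c x)) *v ?v) ?v) = l * Re (cip (m0.P (point (snd c x)) *v ?v) ?v)"
    using null u tT unfolding px by (simp add: metric_cip m0.metric_cip)
  have B: "0 \<le> Re (\<Sum>i\<in>UNIV. \<Sum>j\<in>UNIV. a $ i * cnj (a $ j) * ?B i j)" for a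
    using curvature_comparison[OF k.l.local_higgs_metric_axioms k0.l.local_higgs_metric_axioms dom_S null_S]
    unfolding px .
  have "0 \<le> Re (\<Sum>i\<in>UNIV. \<Sum>j\<in>UNIV. matrix_inv (g c x) $ j $ i * ?B i j)"
  proof (rule trace_nonneg[OF _ _ B])
    have herm: "g c x $ j $ i = cnj (g c x $ i $ j)" for i j
      using assms(3) cA unfolding hermitian_metric_def by blast
    show "adj (g c x) = g c x" unfolding adj_def vec_eq_iff vec_lambda_beta herm[symmetric] by blast
    show "0 < Re (form_of_matrix (g c x) v v)" if "v \<noteq> 0" for v
      using assms(3) cA that unfolding hermitian_metric_def form_of_matrix_def by blast
  qed
  also have "(\<Sum>i\<in>UNIV. \<Sum>j\<in>UNIV. matrix_inv (g c x) $ j $ i * ?B i j) =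
      hym_tensor \<A> E \<T> g \<theta> h x u u - l * hym_tensor \<A> E \<T> g \<theta> h\<^sub>0 x u u"
    unfolding hym hym0 by (simp add: right_diff_distrib sum_subtractf sum_distrib_left mult.left_commute)
  finally have "l * Re (hym_tensor \<A> E \<T> g \<theta> h\<^sub>0 x u u) \<le> Re (hym_tensor \<A> E \<T> g \<theta> h x u u)" by simp
  also have "\<dots> \<le> Re (hym_tensor \<A> E \<T> g \<theta> h\<^sub>0 x u u)"
    using assms(9) x u(1) unfolding tensor_le_def by blast
  finally have "l * Re (hym_tensor \<A> E \<T> g \<theta> h\<^sub>0 x u u) \<le> 1 * Re (hym_tensor \<A> E \<T> g \<theta> h\<^sub>0 x u u)" by simp
  moreover have "0 < Re (hym_tensor \<A> E \<T> g \<theta> h\<^sub>0 x u u)"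
    using assms(8) x u unfolding tensor_pos_def by blast
  ultimately show False using l1 by simp
qed

end
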